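(* Let $P$ be a finite poset, let $K$ be a field, and let $\mathcal{I}(P)$ be the distributive lattice of poset ideals of $P$. Then the following statements are equivalent: (i) There exists a unique compatible algebra with straightening laws (ASL) on $\mathcal{I}(P)$ over $K$ (uniqueness being up to the identification $\equiv$, i.e. any two compatible ASL on $\mathcal{I}(P)$ over $K$ have the same straightening relations). (ii) $K[\mathcal{O}(P)]\equiv K[\mathcal{C}(P)]\equiv K[\mathcal{C}(P^\ast)]$, where $P^\ast$ denotes the dual poset of $P$ and the three rings are regarded as compatible ASL on $\mathcal{I}(P)$ over $K$ via the maps $\varphi_{\mathcal{O}}$, $\psi$ and $\delta$ respectively. (iii) Each connected component of $P$ is a chain, that is, $P$ is a direct sum (disjoint union) of chains.
   Context: Let $P=\{p_1,\ldots,p_n\}$ be a finite poset. A poset ideal of $P$ is a subset $\alpha\subseteq P$ such that $p\in\alpha$, $q\in P$, $q\le p$ imply $q\in\alpha$. $\mathcal{I}(P)$ denotes the set of all poset ideals of $P$ (including $\emptyset$ and $P$), ordered by inclusion; it is a distributive lattice with meet $\cap$ and join $\cup$. A filter of $P$ is a subset $\gamma$ such that $p\in\gamma$, $q\in P$, $q\ge p$ imply $q\in\gamma$. Connected components of $P$ are those of its comparability graph; in a direct sum of chains, elements from different chains are incomparable. **ASL.** Let $K$ be a field, $R=\bigoplus_{i\ge 0}R_i$ a graded $K$-algebra with $R_0=K$, $H$ a finite poset, and $\varphi:H\to R$ an injective map sending each $\alpha\in H$ to a homogeneous element $\varphi(\alpha)$ with $\deg\varphi(\alpha)\ge 1$.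 A standard monomial in $R$ is a product $\varphi(\alpha_1)\varphi(\alpha_2)\cdots\varphi(\alpha_k)$ with $\alpha_1\le\alpha_2\le\cdots\le\alpha_k$ in $H$. $R$ (with $\varphi$) is an algebra with straightening laws (ASL) on $H$ over $K$ if: (1) the set of standard monomials is a $K$-basis of $R$; (2) if $\alpha,\beta\in H$ are incomparable and $\varphi(\alpha)\varphi(\beta)=\sum_i c_i\,\varphi(\gamma_{i1})\cdots\varphi(\gamma_{ik_i})$, with $c_i\in K\setminus\{0\}$ and $\gamma_{i1}\le\cdots\le\gamma_{ik_i}$, is the unique expression of $\varphi(\alpha)\varphi(\beta)$ as a linear combination of standard monomials, then $\gamma_{i1}\le\alpha$ and $\gamma_{i1}\le\beta$ for all $i$. The relations in (2) are the straightening relations of $R$. **Compatible ASL.** Let $S=K[x_1,\ldots,x_n,t]$ be the polynomial ring and let $\{w_\alpha\}_{\alpha\in\mathcal{I}(P)}$ be a set of monomials in $x_1,\ldots,x_n$ indexed by $\mathcal{I}(P)$. Put $\omega_\alpha=w_\alpha t$, $\Omega=\{\omega_\alpha\}_{\alpha\in\mathcal{I}(P)}$, and let $K[\Omega]\subset S$ be the toric ring generated over $K$ by $\Omega$, graded by $\deg\omega_\alpha=1$ for all $\alpha$. Let $\varphi:\mathcal{I}(P)\to K[\Omega]$ be the injective map $\varphi(\alpha)=\omega_\alpha$, and assume that $K[\Omega]$ with $\varphi$ is an ASL on $\mathcal{I}(P)$ over $K$. It is called a compatible ASL if each of its straightening relations is of the form $\varphi(\alpha)\varphi(\alpha')=\varphi(\beta)\varphi(\beta')$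 with $\beta\subseteq\alpha\cap\alpha'$ and $\beta'\supseteq\alpha\cup\alpha'$, where $\alpha,\alpha'$ are incomparable elements of $\mathcal{I}(P)$. Two compatible ASL $K[\Omega]$ and $K[\Omega']$ on $\mathcal{I}(P)$ over $K$ are identified, written $K[\Omega]\equiv K[\Omega']$, if they have the same straightening relations, i.e. for every pair of incomparable $\alpha,\alpha'\in\mathcal{I}(P)$ the associated pair $(\beta,\beta')$ is the same for both. **The three rings.** For $W\subseteq P$ let $u_W=\prod_{p_i\in W}x_i$ (with $u_\emptyset=1$). - $K[\mathcal{O}(P)]$ (toric ring of the order polytope, the Hibi ring) is generated over $K$ by the monomials $u_\alpha t$, $\alpha\in\mathcal{I}(P)$. It is an ASL on $\mathcal{I}(P)$ via $\varphi_{\mathcal{O}}(\alpha)=u_\alpha t$, with straightening relations $\varphi_{\mathcal{O}}(\alpha)\varphi_{\mathcal{O}}(\beta)=\varphi_{\mathcal{O}}(\alpha\cap\beta)\varphi_{\mathcal{O}}(\alpha\cup\beta)$ for incomparable $\alpha,\beta$. - $K[\mathcal{C}(P)]$ (toric ring of the chain polytope) is generated over $K$ by the monomials $u_A t$ with $A$ an antichain of $P$ (a subset whose distinct elements are pairwise incomparable; $\emptyset$ is included). It is an ASL on $\mathcal{I}(P)$ via $\psi(\alpha)=u_{\max\alpha}t$, where $\max\alpha$ is the set of maximal elements of $\alpha$, with straightening relations $\psi(\alpha)\psi(\beta)=\psi(\alpha\ast\beta)\psi(\alpha\cup\beta)$ for incomparable $\alpha,\beta$, where $\alpha\ast\beta$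 is the poset ideal of $P$ generated by $\max(\alpha\cap\beta)\cap(\max\alpha\cup\max\beta)$. - $K[\mathcal{C}(P^\ast)]$, with $P^\ast$ the dual poset (reversed order), is regarded as an ASL on $\mathcal{I}(P)$ via $\delta(\alpha)=u_{\min\overline{\alpha}}t$, where $\overline{\alpha}=P\setminus\alpha$ is the complementary filter and $\min\overline{\alpha}$ is its set of minimal elements, with straightening relations $\delta(\alpha)\delta(\beta)=\delta(\alpha\cap\beta)\delta(\alpha\circ\beta)$ for incomparable $\alpha,\beta$, where $\alpha\circ\beta$ is the poset ideal that is the complement in $P$ of the filter generated by $\min(\overline{\alpha}\cap\overline{\beta})\cap(\min\overline{\alpha}\cup\min\overline{\beta})$. All three are compatible ASL on $\mathcal{I}(P)$ over $K$. *)

theory Defs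
  imports Complex_Main "HOL-Library.Poly_Mapping"
begin

section \<open>Finite posets\<close>

text \<open>
  A finite poset is a finite subset \<open>P\<close> of a partially ordered type, with the induced order.
  The empty poset is allowed.
\<close>

definition poset_ideals :: "'a::order set \<Rightarrow> 'a set set" where
  "poset_ideals P = {\<alpha>. \<alpha> \<subseteq> P \<and> (\<forall>p\<in>\<alpha>. \<forall>q\<in>P. q \<le> p \<longrightarrow> q \<in> \<alpha>)}"

definition maximal_elements :: "'a::order set \<Rightarrow> 'a set" where
  "maximal_elements A = {p \<in> A. \<forall>q\<in>A. p \<le> q \<longrightarrow> q = p}"

definition minimal_elements :: "'a::order set \<Rightarrow> 'a set" where
  "minimal_elements A = {p \<in> A. \<forall>q\<in>A. q \<le> p \<longrightarrow> q = p}"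

definition incomparable :: "'a::order \<Rightarrow> 'a \<Rightarrow> bool" where
  "incomparable p q \<longleftrightarrow> \<not> p \<le> q \<and> \<not> q \<le> p"

definition antichains :: "'a::order set \<Rightarrow> 'a set set" where
  "antichains P = {A. A \<subseteq> P \<and> (\<forall>p\<in>A. \<forall>q\<in>A. p \<noteq> q \<longrightarrow> incomparable p q)}"

definition comparability_graph :: "'a::order set \<Rightarrow> ('a \<times> 'a) set" where
  "comparability_graph P = {(p, q). p \<in> P \<and> q \<in> P \<and> p \<noteq> q \<and> (p \<le> q \<or> q \<le> p)}"

definition connected_components :: "'a::order set \<Rightarrow> 'a set set" where
  "connected_components P = P // (comparability_graph P)\<^sup>*"


section \<open>Algebras with straightening laws\<close>

text \<open>
  A multichain \<open>\<alpha>\<^sub>1 \<le> \<dots> \<le> \<alpha>\<^sub>k\<close> is a sorted list; \<open>k = 0\<close> gives the standard monomial \<open>1\<close>.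
\<close>

definition multichains :: "'h::order set \<Rightarrow> 'h list set" where
  "multichains H = {\<gamma>. set \<gamma> \<subseteq> H \<and> sorted_wrt (\<le>) \<gamma>}"

definition std_monomial :: "('h \<Rightarrow> 'r::comm_ring_1) \<Rightarrow> 'h list \<Rightarrow> 'r" where
  "std_monomial \<phi> \<gamma> = prod_list (map \<phi> \<gamma>)"

text \<open>
  \<open>c\<close> lists the coefficients of an expression of \<open>r\<close> as a linear combination of standard
  monomials.
\<close>

definition standard_expression ::
  "('k::field \<Rightarrow> 'r::comm_ring_1 \<Rightarrow> 'r) \<Rightarrow> 'h::order set \<Rightarrow> ('h \<Rightarrow> 'r) \<Rightarrow> ('h list \<Rightarrow> 'k) \<Rightarrow> 'r \<Rightarrow> bool"
  where
  "standard_expression scale H \<phi> c r \<longleftrightarrow>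
     finite {\<gamma>. c \<gamma> \<noteq> 0} \<and> {\<gamma>. c \<gamma> \<noteq> 0} \<subseteq> multichains H \<and>
     r = (\<Sum>\<gamma> | c \<gamma> \<noteq> 0. scale (c \<gamma>) (std_monomial \<phi> \<gamma>))"

definition straightening_relation ::
  "('k::field \<Rightarrow> 'r::comm_ring_1 \<Rightarrow> 'r) \<Rightarrow> 'h::order set \<Rightarrow> ('h \<Rightarrow> 'r) \<Rightarrow> 'h \<Rightarrow> 'h \<Rightarrow> ('h list \<Rightarrow> 'k) \<Rightarrow> bool"
  where
  "straightening_relation scale H \<phi> \<alpha> \<beta> c \<longleftrightarrow>
     \<alpha> \<in> H \<and> \<beta> \<in> H \<and> incomparable \<alpha> \<beta> \<and> standard_expression scale H \<phi> c (\<phi> \<alpha> * \<phi> \<beta>)"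

text \<open>
  The graded algebra is a subset \<open>R\<close> of a commutative \<open>K\<close>-algebra \<open>'r\<close>; the field \<open>K\<close> is the type
  \<open>'k\<close> and embeds into \<open>R\<close> by \<open>c \<mapsto> scale c 1\<close>. \<open>G i\<close> is the homogeneous component of degree \<open>i\<close>.
\<close>

locale graded_algebra = vector_space scale
  for scale :: "'k::field \<Rightarrow> 'r::comm_ring_1 \<Rightarrow> 'r" +
  fixes R :: "'r set" and G :: "nat \<Rightarrow> 'r set"
  assumes scale_mult: "scale c (x * y) = scale c x * y"
    and subspace_R: "subspace R"
    and one_R: "1 \<in> R"
    and mult_R: "x \<in> R \<Longrightarrow> y \<in> R \<Longrightarrow> x * y \<in> R"
    and subspace_G: "subspace (G i)"
    and G_subset: "G i \<subseteq> R"
    and mult_G: "x \<in> G i \<Longrightarrow> y \<in> G j \<Longrightarrow> x * y \<in> G (i + j)"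
    and G_0: "G 0 = range (\<lambda>c. scale c 1)"
    and direct_sum: "r \<in> R \<Longrightarrow>
      \<exists>!f. (\<forall>i. f i \<in> G i) \<and> finite {i. f i \<noteq> 0} \<and> r = (\<Sum>i | f i \<noteq> 0. f i)"

text \<open>
  The standard monomials form a basis as a family: distinct multichains have distinct standard
  monomials. Without this, the expression in \<open>straightening\<close> would not be unique.
\<close>

locale asl = graded_algebra scale R G
  for scale :: "'k::field \<Rightarrow> 'r::comm_ring_1 \<Rightarrow> 'r" and R G +
  fixes H :: "'h::order set" and \<phi> :: "'h \<Rightarrow> 'r"
  assumes finite_H: "finite H"
    and inj_\<phi>: "inj_on \<phi> H"
    and homogeneous: "\<alpha> \<in> H \<Longrightarrow> \<exists>d\<ge>1. \<phi> \<alpha> \<in> G d"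
    and std_monomials_distinct: "inj_on (std_monomial \<phi>) (multichains H)"
    and std_monomials_independent: "independent (std_monomial \<phi> ` multichains H)"
    and std_monomials_span: "span (std_monomial \<phi> ` multichains H) = R"
    and straightening:
      "straightening_relation scale H \<phi> \<alpha> \<beta> c \<Longrightarrow> c \<gamma> \<noteq> 0 \<Longrightarrow>
         \<gamma> \<noteq> [] \<and> hd \<gamma> \<le> \<alpha> \<and> hd \<gamma> \<le> \<beta>"


section \<open>Toric rings\<close>

datatype 'a var = X 'a | T

text \<open>
  Polynomials over \<open>'k\<close> in the variables \<open>X p\<close> and \<open>T\<close>, as finitely supported functions on
  exponent vectors. The ring \<open>S\<close> is the part involving only \<open>T\<close> and \<open>X p\<close> with \<open>p \<in> P\<close>.
\<close>

type_synonym ('a, 'k) polynomial = "('a var \<Rightarrow>\<^sub>0 nat) \<Rightarrow>\<^sub>0 'k"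

definition variable :: "'a var \<Rightarrow> ('a, 'k::field) polynomial" where
  "variable v = Poly_Mapping.single (Poly_Mapping.single v 1) 1"

definition poly_scale :: "'k::field \<Rightarrow> ('a, 'k) polynomial \<Rightarrow> ('a, 'k) polynomial" where
  "poly_scale c f = Poly_Mapping.single 0 c * f"

definition x_monomials :: "'a set \<Rightarrow> ('a, 'k::field) polynomial set" where
  "x_monomials P = {\<Prod>p\<in>P. variable (X p) ^ e p | e. True}"

definition u :: "'a set \<Rightarrow> ('a, 'k::field) polynomial" where
  "u W = (\<Prod>p\<in>W. variable (X p))"

inductive_set toric_ring :: "('a, 'k::field) polynomial set \<Rightarrow> ('a, 'k) polynomial set"
  for \<Omega> where
  const: "poly_scale c 1 \<in> toric_ring \<Omega>"
| gen: "f \<in> \<Omega> \<Longrightarrow> f \<in> toric_ring \<Omega>"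
| add: "f \<in> toric_ring \<Omega> \<Longrightarrow> g \<in> toric_ring \<Omega> \<Longrightarrow> f + g \<in> toric_ring \<Omega>"
| mult: "f \<in> toric_ring \<Omega> \<Longrightarrow> g \<in> toric_ring \<Omega> \<Longrightarrow> f * g \<in> toric_ring \<Omega>"

text \<open>The grading in which every generator has degree \<open>1\<close>.\<close>

definition toric_grading :: "('a, 'k::field) polynomial set \<Rightarrow> nat \<Rightarrow> ('a, 'k) polynomial set" where
  "toric_grading \<Omega> i = module.span poly_scale {prod_list fs | fs. set fs \<subseteq> \<Omega> \<and> length fs = i}"


section \<open>Compatible ASL on the lattice of poset ideals\<close>

definition omega :: "('a set \<Rightarrow> ('a, 'k::field) polynomial) \<Rightarrow> 'a set \<Rightarrow> ('a, 'k) polynomial" where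
  "omega w \<alpha> = w \<alpha> * variable T"

text \<open>
  The ring \<open>K[\<Omega>]\<close> together with the map \<open>\<alpha> \<mapsto> \<omega>\<^sub>\<alpha>\<close> is given by the family \<open>w\<close> of monomials;
  only its values on \<open>poset_ideals P\<close> matter.
\<close>

definition toric_asl :: "'a::order set \<Rightarrow> ('a set \<Rightarrow> ('a, 'k::field) polynomial) \<Rightarrow> bool" where
  "toric_asl P w \<longleftrightarrow>
     (\<forall>\<alpha>\<in>poset_ideals P. w \<alpha> \<in> x_monomials P) \<and>
     asl poly_scale
       (toric_ring (omega w ` poset_ideals P)) (toric_grading (omega w ` poset_ideals P))
       (poset_ideals P) (omega w)"

text \<open>
  The coefficient function of \<open>\<phi>(\<beta>) \<phi>(\<beta>')\<close> is the indicator function of the multichain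
  \<open>[\<beta>, \<beta>']\<close>.
\<close>

definition compatible_asl :: "'a::order set \<Rightarrow> ('a set \<Rightarrow> ('a, 'k::field) polynomial) \<Rightarrow> bool" where
  "compatible_asl P w \<longleftrightarrow>
     toric_asl P w \<and>
     (\<forall>\<alpha> \<alpha>' c. straightening_relation poly_scale (poset_ideals P) (omega w) \<alpha> \<alpha>' c \<longrightarrow>
        (\<exists>\<beta>\<in>poset_ideals P. \<exists>\<beta>'\<in>poset_ideals P. \<beta> \<subseteq> \<alpha> \<inter> \<alpha>' \<and> \<alpha> \<union> \<alpha>' \<subseteq> \<beta>' \<and>
           c = (\<lambda>\<gamma>. if \<gamma> = [\<beta>, \<beta>'] then 1 else 0)))"

definition asl_equiv ::
  "'a::order set \<Rightarrow> ('a set \<Rightarrow> ('a, 'k::field) polynomial) \<Rightarrow> ('a set \<Rightarrow> ('a, 'k) polynomial) \<Rightarrow> bool"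
  where
  "asl_equiv P w w' \<longleftrightarrow>
     compatible_asl P w \<and> compatible_asl P w' \<and>
     (\<forall>\<alpha> \<alpha>' c. straightening_relation poly_scale (poset_ideals P) (omega w) \<alpha> \<alpha>' c \<longleftrightarrow>
               straightening_relation poly_scale (poset_ideals P) (omega w') \<alpha> \<alpha>' c)"

text \<open>
  The families giving \<open>K[\<O>(P)]\<close>, \<open>K[\<C>(P)]\<close> and \<open>K[\<C>(P\<^sup>*)]\<close>. For the last, the minimal elements
  of the complementary filter are its maximal elements in the dual poset.
\<close>

definition order_family :: "'a::order set \<Rightarrow> 'a set \<Rightarrow> ('a, 'k::field) polynomial" where
  "order_family P \<alpha> = u \<alpha>"

definition chain_family :: "'a::order set \<Rightarrow> 'a set \<Rightarrow> ('a, 'k::field) polynomial" where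
  "chain_family P \<alpha> = u (maximal_elements \<alpha>)"

definition dual_chain_family :: "'a::order set \<Rightarrow> 'a set \<Rightarrow> ('a, 'k::field) polynomial" where
  "dual_chain_family P \<alpha> = u (minimal_elements (P - \<alpha>))"

text \<open>
  \<open>K[\<C>(P)]\<close> and \<open>K[\<C>(P\<^sup>*)]\<close> are generated by the monomials of antichains; \<open>P\<close> and \<open>P\<^sup>*\<close> have the
  same antichains.
\<close>

lemma maximal_elements_ideals: "maximal_elements ` poset_ideals P = antichains P"
proof (intro equalityI subsetI)
  fix A assume "A \<in> maximal_elements ` poset_ideals P"
  then show "A \<in> antichains P"
    by (auto simp: maximal_elements_def poset_ideals_def antichains_def incomparable_def)
next
  fix A assume A: "A \<in> antichains P"
  define \<alpha> where "\<alpha> = {q\<in>P. \<exists>p\<in>A. q \<le> p}"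
  have "\<alpha> \<in> poset_ideals P"
    unfolding \<alpha>_def poset_ideals_def by (auto intro: order_trans)
  moreover have "A = maximal_elements \<alpha>"
    using A unfolding \<alpha>_def maximal_elements_def antichains_def incomparable_def
    by (auto intro: order_trans antisym) (metis antisym order_trans subsetD)+
  ultimately show "A \<in> maximal_elements ` poset_ideals P" by blast
qed

lemma minimal_elements_filters:
  "(\<lambda>\<alpha>. minimal_elements (P - \<alpha>)) ` poset_ideals P = antichains P"
proof (intro equalityI subsetI)
  fix A assume "A \<in> (\<lambda>\<alpha>. minimal_elements (P - \<alpha>)) ` poset_ideals P"
  then show "A \<in> antichains P"
    by (auto simp: minimal_elements_def poset_ideals_def antichains_def incomparable_def)
next
  fix A assume A: "A \<in> antichains P"
  define \<gamma> where "\<gamma> = {q\<in>P. \<exists>p\<in>A. p \<le> q}"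
  have "P - \<gamma> \<in> poset_ideals P"
    unfolding \<gamma>_def poset_ideals_def by (auto intro: order_trans)
  moreover have "A = minimal_elements \<gamma>"
    using A unfolding \<gamma>_def minimal_elements_def antichains_def incomparable_def
    by (auto intro: order_trans antisym) (metis antisym order_trans subsetD)+
  moreover have "P - (P - \<gamma>) = \<gamma>" by (auto simp: \<gamma>_def)
  ultimately show "A \<in> (\<lambda>\<alpha>. minimal_elements (P - \<alpha>)) ` poset_ideals P" by (metis imageI)
qed

lemma omega_chain_family:
  "omega (chain_family P) ` poset_ideals P = (\<lambda>A. u A * variable T) ` antichains P"
  unfolding maximal_elements_ideals[symmetric] by (simp add: omega_def chain_family_def image_image)

lemma omega_dual_chain_family:
  "omega (dual_chain_family P) ` poset_ideals P = (\<lambda>A. u A * variable T) ` antichains P"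
  unfolding minimal_elements_filters[symmetric]
  by (simp add: omega_def dual_chain_family_def image_image)

end

theory Submission
  imports Defs "HOL-Library.Multiset"
begin

text \<open>
  Every generator of a toric ring is a monomial, so a compatible ASL is a statement about the
  exponent vectors \<open>e \<alpha>\<close> of the generators \<open>\<omega>\<^sub>\<alpha>\<close>. Distinct monomials are linearly independent;
  hence \<open>w\<close> gives a compatible ASL exactly when distinct multichains of ideals have distinct
  exponent sums and every pair of incomparable ideals satisfies an equation
  \<open>e \<alpha> + e \<alpha>' = e \<beta> + e \<beta>'\<close> with \<open>\<beta> \<subseteq> \<alpha> \<inter> \<alpha>'\<close> and \<open>\<alpha> \<union> \<alpha>' \<subseteq> \<beta>'\<close> (\<open>compatible_aslI\<close> and, conversely,
  \<open>compatible_asl_inj\<close> and \<open>compatible_asl_straightens\<close>). The standard monomials span because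
  replacing \<open>\<alpha>, \<alpha>'\<close> by \<open>\<beta>, \<beta>'\<close> increases the sum of \<open>2 ^ card \<alpha>\<close> over the factors, so that
  straightening ends.

  With this criterion the three rings of the theorem are compatible ASL on every finite poset, so
  uniqueness forces them to be equivalent.

  If they are equivalent, then comparability is a transitive relation on \<open>P\<close>, that is, the
  components are chains. Suppose that \<open>q\<close> lies below two incomparable elements \<open>p\<close> and \<open>r\<close>. Let
  \<open>\<alpha>\<close> and \<open>\<beta>\<close> be the principal ideals of \<open>p\<close> and \<open>r\<close>. In the order polytope ring, \<open>\<alpha>, \<beta>\<close>
  straighten to \<open>\<alpha> \<inter> \<beta>, \<alpha> \<union> \<beta>\<close>. In the chain polytope ring the product for \<open>\<alpha>, \<beta>\<close> involves only
  \<open>x\<^sub>p\<close>, \<open>x\<^sub>r\<close> and \<open>t\<close>, whereas the generator of \<open>\<alpha> \<inter> \<beta>\<close> involves a maximal element of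
  \<open>\<alpha> \<inter> \<beta>\<close>, which is neither \<open>p\<close> nor \<open>r\<close>. The dual chain polytope excludes a common upper bound in
  the same way (\<open>comparability_transitive_of_equiv\<close>).

  Conversely let \<open>P\<close> be a disjoint union of chains, and take any compatible ASL. The decisive step
  is that \<open>e\<close> is additive over a decomposition of \<open>P\<close> into two parts without comparabilities
  between them (\<open>compatible_disjoint_additive\<close>). Splitting off one chain after the other reduces
  the equation \<open>e \<alpha> + e \<alpha>' = e (\<alpha> \<inter> \<alpha>') + e (\<alpha> \<union> \<alpha>')\<close> to a single chain, on which \<open>\<alpha>\<close> and \<open>\<alpha>'\<close>
  are comparable and the equation is trivial. So every compatible ASL has the straightening
  relations of the order polytope ring.
\<close>

section \<open>Monomials as exponent vectors\<close>

abbreviation monomial :: "('a var \<Rightarrow>\<^sub>0 nat) \<Rightarrow> ('a, 'k::field) polynomial" where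
  "monomial m \<equiv> Poly_Mapping.single m 1"

lemma monomial_mult: "monomial m * monomial n = monomial (m + n)"
  by (simp add: mult_single)

lemma monomial_eq_iff [simp]: "monomial m = monomial n \<longleftrightarrow> m = n"
  by (metis lookup_single_eq lookup_single_not_eq zero_neq_one)

lemma monomial_power: "monomial m ^ k = monomial (\<Sum>i<k. m)"
  by (induction k) (simp_all add: monomial_mult add.commute)

lemma monomial_prod: "(\<Prod>p\<in>A. monomial (f p)) = monomial (\<Sum>p\<in>A. f p)"
  by (induction A rule: infinite_finite_induct) (simp_all add: monomial_mult)

lemma monomial_prod_list: "prod_list (map (\<lambda>x. monomial (f x)) xs) = monomial (sum_list (map f xs))"
  by (induction xs) (simp_all add: monomial_mult)

lemma lookup_poly_scale: "Poly_Mapping.lookup (poly_scale c f) m = c * Poly_Mapping.lookup f m"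
proof -
  have "poly_scale c f = Poly_Mapping.map ((*) c) f"
    unfolding poly_scale_def by (rule mult_map_scale_conv_mult[symmetric])
  then show ?thesis by (simp add: map.rep_eq when_def)
qed

interpretation poly: vector_space poly_scale
  by unfold_locales
    (auto simp: poly_scale_def algebra_simps single_add mult_single simp flip: mult.assoc)

lemma poly_scale_mult: "poly_scale c (f * g) = poly_scale c f * g"
  by (simp add: poly_scale_def mult.assoc)

lemma poly_scale_mult_right: "poly_scale c (f * g) = f * poly_scale c g"
  by (simp add: poly_scale_def ac_simps)

lemma independent_monomials: "poly.independent (monomial ` A)"
  unfolding poly.independent_explicit_module
proof (intro allI impI)
  fix t c v
  assume t: "finite t" "t \<subseteq> monomial ` A" "(\<Sum>v\<in>t. poly_scale (c v) v) = 0" "v \<in> t"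
  obtain m where m: "v = monomial m" using t by auto
  have "0 = (\<Sum>w\<in>t. c w * Poly_Mapping.lookup w m)"
    using arg_cong[OF t(3), of "\<lambda>f. Poly_Mapping.lookup f m"]
    by (simp add: lookup_sum lookup_poly_scale)
  also have "\<dots> = (\<Sum>w\<in>t. if w = v then c w else 0)"
  proof (rule sum.cong)
    fix w assume "w \<in> t"
    then obtain n where "w = monomial n" using t by auto
    then show "c w * Poly_Mapping.lookup w m = (if w = v then c w else 0)"
      by (auto simp: m lookup_single when_def)
  qed simp
  also have "\<dots> = c v" using t by simp
  finally show "c v = 0" by simp
qed

lemma span_mult:
  assumes "f \<in> poly.span A" "g \<in> poly.span B" and AB: "\<And>a b. a \<in> A \<Longrightarrow> b \<in> B \<Longrightarrow> a * b \<in> C"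
  shows "f * g \<in> poly.span C"
  using assms(1)
proof (induction rule: poly.span_induct_alt)
  case base
  show ?case by (simp add: poly.span_zero)
next
  case (step c a f)
  have "a * g \<in> poly.span C"
    using assms(2)
  proof (induction rule: poly.span_induct_alt)
    case base
    show ?case by (simp add: poly.span_zero)
  next
    case (step d b g)
    have "a * (poly_scale d b + g) = poly_scale d (a * b) + a * g"
      by (simp add: distrib_left poly_scale_mult_right)
    then show ?case using step AB[OF \<open>a \<in> A\<close>]
      by (simp add: poly.span_add poly.span_scale poly.span_base)
  qed
  then show ?case using step
    by (simp add: distrib_right poly.span_add poly.span_scale flip: poly_scale_mult)
qed

definition x_vector :: "'a set \<Rightarrow> ('a \<Rightarrow> nat) \<Rightarrow> ('a var \<Rightarrow>\<^sub>0 nat)" where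
  "x_vector A k = (\<Sum>p\<in>A. Poly_Mapping.single (X p) (k p))"

lemma sum_single: "(\<Sum>i<k. Poly_Mapping.single v (1::nat)) = Poly_Mapping.single v k"
  by (induction k) (simp_all flip: single_add)

lemma prod_variables: "(\<Prod>p\<in>A. variable (X p) ^ k p) = monomial (x_vector A k)"
  by (simp add: variable_def monomial_power monomial_prod x_vector_def sum_single del: One_nat_def)

lemma x_monomials_eq: "x_monomials A = {monomial (x_vector A k) | k. True}"
  by (simp add: x_monomials_def prod_variables)

lemma lookup_x_vector_X:
  "finite A \<Longrightarrow> Poly_Mapping.lookup (x_vector A k) (X p) = (if p \<in> A then k p else 0)"
  by (simp add: x_vector_def lookup_sum lookup_single when_def)

lemma lookup_x_vector_T: "Poly_Mapping.lookup (x_vector A k) T = 0"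
  by (simp add: x_vector_def lookup_sum lookup_single when_def)

lemma u_eq:
  assumes "finite P" "W \<subseteq> P"
  shows "u W = monomial (x_vector P (\<lambda>p. of_bool (p \<in> W)))"
proof -
  have "(\<Sum>p\<in>W. Poly_Mapping.single (X p) 1) = x_vector P (\<lambda>p. of_bool (p \<in> W))"
    unfolding x_vector_def using assms by (intro sum.mono_neutral_cong_left) auto
  then show ?thesis by (simp add: u_def variable_def monomial_prod del: One_nat_def)
qed

text \<open>
  Sums of products of generators already form a ring, so the inductively generated ring is a mere
  linear span, on which linear algebra with monomials applies.
\<close>
lemma toric_ring_eq_span: "toric_ring \<Omega> = poly.span {prod_list fs | fs. set fs \<subseteq> \<Omega>}"
  (is "_ = poly.span ?M")
proof (intro equalityI subsetI)
  fix f assume "f \<in> toric_ring \<Omega>"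
  then show "f \<in> poly.span ?M"
  proof induction
    case (const c)
    have "1 \<in> ?M" by (auto intro: exI[of _ "[]"])
    then show ?case by (simp add: poly.span_base poly.span_scale)
  next
    case (gen f)
    then have "f \<in> ?M" by (auto intro: exI[of _ "[f]"])
    then show ?case by (rule poly.span_base)
  next
    case (mult f g)
    show ?case
    proof (rule span_mult[OF mult.IH])
      fix a b assume "a \<in> ?M" "b \<in> ?M"
      then obtain fs gs where "a = prod_list fs" "b = prod_list gs" "set fs \<subseteq> \<Omega>" "set gs \<subseteq> \<Omega>"
        by auto
      then show "a * b \<in> ?M" by (auto intro!: exI[of _ "fs @ gs"])
    qed
  qed (rule poly.span_add)
next
  fix f assume "f \<in> poly.span ?M"
  then show "f \<in> toric_ring \<Omega>"
  proof (induction rule: poly.span_induct_alt)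
    case base
    show ?case using toric_ring.const[of 0] by simp
  next
    case (step c a f)
    obtain fs where fs: "a = prod_list fs" "set fs \<subseteq> \<Omega>" using step by auto
    from fs(2) have "prod_list fs \<in> toric_ring \<Omega>"
    proof (induction fs)
      case Nil
      show ?case using toric_ring.const[of 1] by simp
    qed (simp add: toric_ring.intros)
    moreover have "poly_scale c a = poly_scale c 1 * a" by (simp flip: poly_scale_mult)
    ultimately show ?case using step fs by (simp add: toric_ring.intros)
  qed
qed

section \<open>Toric rings of monomial families\<close>

lemma finite_poset_ideals: "finite P \<Longrightarrow> finite (poset_ideals P)"
  by (rule finite_subset[of _ "Pow P"]) (auto simp: poset_ideals_def)

abbreviation exponent_sum :: "('h \<Rightarrow> ('a var \<Rightarrow>\<^sub>0 nat)) \<Rightarrow> 'h list \<Rightarrow> ('a var \<Rightarrow>\<^sub>0 nat)" where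
  "exponent_sum e \<gamma> \<equiv> sum_list (map e \<gamma>)"

text \<open>
  The relation \<open>\<phi>(\<alpha>) \<phi>(\<alpha>') = \<phi>(\<beta>) \<phi>(\<beta>')\<close> of a compatible ASL, read off from exponent vectors.
\<close>
definition straightens ::
  "'a::order set \<Rightarrow> ('a set \<Rightarrow> ('a var \<Rightarrow>\<^sub>0 nat)) \<Rightarrow> 'a set \<Rightarrow> 'a set \<Rightarrow> 'a set \<Rightarrow> 'a set \<Rightarrow> bool"
  where
  "straightens P e \<alpha> \<alpha>' \<beta> \<beta>' \<longleftrightarrow> \<beta> \<in> poset_ideals P \<and> \<beta>' \<in> poset_ideals P \<and>
     \<beta> \<subseteq> \<alpha> \<inter> \<alpha>' \<and> \<alpha> \<union> \<alpha>' \<subseteq> \<beta>' \<and> e \<alpha> + e \<alpha>' = e \<beta> + e \<beta>'"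

text \<open>
  The exponent vectors are a parameter and not computed from \<open>w\<close>, so that a concrete family can
  supply them in the form that suits it.
\<close>
locale toric_family =
  fixes P :: "'a::order set" and w :: "'a set \<Rightarrow> ('a, 'k::field) polynomial"
    and e :: "'a set \<Rightarrow> ('a var \<Rightarrow>\<^sub>0 nat)"
  assumes finite_P: "finite P"
    and w_monomial: "\<alpha> \<in> poset_ideals P \<Longrightarrow> w \<alpha> \<in> x_monomials P"
    and omega_eq: "\<alpha> \<in> poset_ideals P \<Longrightarrow> omega w \<alpha> = monomial (e \<alpha>)"
begin

abbreviation "H \<equiv> poset_ideals P"
abbreviation "\<Omega> \<equiv> omega w ` H"

lemma std_monomial_eq: "set \<gamma> \<subseteq> H \<Longrightarrow> std_monomial (omega w) \<gamma> = monomial (exponent_sum e \<gamma>)"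
  unfolding std_monomial_def monomial_prod_list[symmetric]
  by (intro arg_cong[of _ _ prod_list]) (auto simp: omega_eq)

text \<open>
  The variable \<open>T\<close> occurs exactly once in each generator, so the exponent of \<open>T\<close> in a monomial
  counts the generators in any factorization. The grading and the lengths of multichains are
  recovered from it.
\<close>
lemma lookup_e_T:
  assumes "\<alpha> \<in> H"
  shows "Poly_Mapping.lookup (e \<alpha>) T = 1"
proof -
  obtain k where "w \<alpha> = monomial (x_vector P k)"
    using w_monomial[OF assms] by (auto simp: x_monomials_eq)
  then have "monomial (e \<alpha>) = (monomial (x_vector P k + Poly_Mapping.single T 1) :: ('a, 'k) polynomial)"
    using omega_eq[OF assms] by (simp add: omega_def variable_def monomial_mult)
  then show ?thesis by (simp add: lookup_add lookup_x_vector_T)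
qed

lemma lookup_exponent_sum_T: "set \<gamma> \<subseteq> H \<Longrightarrow> Poly_Mapping.lookup (exponent_sum e \<gamma>) T = length \<gamma>"
  by (induction \<gamma>) (auto simp: lookup_add lookup_e_T)

lemma products_eq:
  "{prod_list fs | fs. set fs \<subseteq> \<Omega> \<and> Q (length fs)} =
   {monomial (exponent_sum e \<gamma>) | \<gamma>. set \<gamma> \<subseteq> H \<and> Q (length \<gamma>)}" (is "?L = ?R")
proof (intro equalityI subsetI)
  fix f assume "f \<in> ?L"
  then obtain fs where fs: "f = prod_list fs" "fs \<in> lists (omega w ` H)" "Q (length fs)" by auto
  then obtain \<gamma> where "\<gamma> \<in> lists H" "fs = map (omega w) \<gamma>"
    by (auto simp: lists_image)
  then show "f \<in> ?R" using fs std_monomial_eq[of \<gamma>] by (auto simp: std_monomial_def)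
next
  fix f assume "f \<in> ?R"
  then obtain \<gamma> where \<gamma>: "f = monomial (exponent_sum e \<gamma>)" "set \<gamma> \<subseteq> H" "Q (length \<gamma>)" by auto
  then show "f \<in> ?L" using std_monomial_eq[of \<gamma>]
    by (auto simp: std_monomial_def intro!: exI[of _ "map (omega w) \<gamma>"] imageI)
qed

lemma toric_ring_span: "toric_ring \<Omega> = poly.span {monomial (exponent_sum e \<gamma>) | \<gamma>. set \<gamma> \<subseteq> H}"
  using products_eq[of "\<lambda>_. True"] by (simp add: toric_ring_eq_span)

lemma toric_grading_span:
  "toric_grading \<Omega> i = poly.span {monomial (exponent_sum e \<gamma>) | \<gamma>. set \<gamma> \<subseteq> H \<and> length \<gamma> = i}"
  using products_eq[of "\<lambda>k. k = i"] by (simp add: toric_grading_def)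

lemma toric_grading_homogeneous:
  assumes "f \<in> toric_grading \<Omega> i" "Poly_Mapping.lookup f m \<noteq> 0"
  shows "Poly_Mapping.lookup m T = i"
  using assms unfolding toric_grading_span
proof (induction rule: poly.span_induct_alt)
  case (step c x y)
  then show ?case
    by (auto simp: lookup_add lookup_poly_scale lookup_single when_def lookup_exponent_sum_T split: if_splits)
qed simp

text \<open>
  The components of an element are its parts of fixed degree in \<open>T\<close>; this gives the uniqueness of
  the decomposition.
\<close>
lemma graded_algebra_toric: "graded_algebra poly_scale (toric_ring \<Omega>) (toric_grading \<Omega>)"
proof unfold_locales
  show "toric_grading \<Omega> i \<subseteq> toric_ring \<Omega>" for i
    unfolding toric_grading_span toric_ring_span by (intro poly.span_mono) auto
  show "toric_grading \<Omega> 0 = range (\<lambda>c. poly_scale c 1)"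
    by (simp add: toric_grading_span poly.span_singleton cong: conj_cong)
  show "x * y \<in> toric_grading \<Omega> (i + j)"
    if "x \<in> toric_grading \<Omega> i" "y \<in> toric_grading \<Omega> j" for x y i j
    using that unfolding toric_grading_span
  proof (rule span_mult)
    fix a b :: "('a, 'k) polynomial"
    assume "a \<in> {monomial (exponent_sum e \<gamma>) | \<gamma>. set \<gamma> \<subseteq> H \<and> length \<gamma> = i}"
      and "b \<in> {monomial (exponent_sum e \<gamma>) | \<gamma>. set \<gamma> \<subseteq> H \<and> length \<gamma> = j}"
    then obtain \<gamma> \<delta> where "a = monomial (exponent_sum e \<gamma>)" "b = monomial (exponent_sum e \<delta>)"
      "set (\<gamma> @ \<delta>) \<subseteq> H" "length (\<gamma> @ \<delta>) = i + j" by auto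
    then show "a * b \<in> {monomial (exponent_sum e \<gamma>) | \<gamma>. set \<gamma> \<subseteq> H \<and> length \<gamma> = i + j}"
      by (auto simp: monomial_mult intro!: exI[of _ "\<gamma> @ \<delta>"])
  qed
  show "\<exists>!f. (\<forall>i. f i \<in> toric_grading \<Omega> i) \<and> finite {i. f i \<noteq> 0} \<and> r = (\<Sum>i | f i \<noteq> 0. f i)"
    if r: "r \<in> toric_ring \<Omega>" for r
  proof (rule ex_ex1I)
    obtain t c where t: "finite t" "t \<subseteq> {monomial (exponent_sum e \<gamma>) | \<gamma>. set \<gamma> \<subseteq> H}"
      "r = (\<Sum>a\<in>t. poly_scale (c a) a)"
      using r unfolding toric_ring_span poly.span_explicit by blast
    then have "\<forall>a\<in>t. \<exists>\<gamma>. a = monomial (exponent_sum e \<gamma>) \<and> set \<gamma> \<subseteq> H" by blast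
    then obtain \<gamma> where \<gamma>: "\<And>a. a \<in> t \<Longrightarrow> a = monomial (exponent_sum e (\<gamma> a)) \<and> set (\<gamma> a) \<subseteq> H"
      by metis
    define n where "n a = length (\<gamma> a)" for a
    define f where "f i = (\<Sum>a | a \<in> t \<and> n a = i. poly_scale (c a) a)" for i
    have "f i \<in> toric_grading \<Omega> i" for i
      unfolding f_def toric_grading_span using \<gamma>
      by (intro poly.span_sum poly.span_scale poly.span_base) (auto simp: n_def)
    moreover have supp: "{i. f i \<noteq> 0} \<subseteq> n ` t"
      unfolding f_def by (auto elim!: sum.not_neutral_contains_not_neutral)
    moreover have "r = (\<Sum>i\<in>n ` t. f i)"
      unfolding f_def t(3) using t(1) by (intro sum.image_gen)
    moreover have "(\<Sum>i\<in>n ` t. f i) = (\<Sum>i | f i \<noteq> 0. f i)"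
      using supp t(1) by (intro sum.mono_neutral_right) auto
    ultimately show "\<exists>f. (\<forall>i. f i \<in> toric_grading \<Omega> i) \<and> finite {i. f i \<noteq> 0} \<and>
        r = (\<Sum>i | f i \<noteq> 0. f i)"
      using t(1) by (metis finite_imageI finite_subset)
  next
    \<comment> \<open>Any decomposition is read off from \<open>r\<close> itself by sorting its monomials by the exponent of \<open>T\<close>.\<close>
    have component: "Poly_Mapping.lookup (f i) m =
        (if Poly_Mapping.lookup m T = i then Poly_Mapping.lookup r m else 0)"
      if f: "\<forall>i. f i \<in> toric_grading \<Omega> i" "finite {i. f i \<noteq> 0}" "r = (\<Sum>i | f i \<noteq> 0. f i)"
      for f i m
    proof -
      let ?d = "Poly_Mapping.lookup m T"
      have zero: "Poly_Mapping.lookup (f j) m = 0" if "j \<noteq> ?d" for j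
        using toric_grading_homogeneous f(1) that by metis
      have "Poly_Mapping.lookup r m = (\<Sum>j | f j \<noteq> 0. Poly_Mapping.lookup (f j) m)"
        by (subst f(3)) (simp add: lookup_sum)
      also have "\<dots> = (\<Sum>j\<in>{j. f j \<noteq> 0} \<union> {?d}. Poly_Mapping.lookup (f j) m)"
        using f(2) by (intro sum.mono_neutral_left) auto
      also have "\<dots> = (\<Sum>j\<in>{?d}. Poly_Mapping.lookup (f j) m)"
        using f(2) zero by (intro sum.mono_neutral_right) auto
      finally show ?thesis using zero by auto
    qed
    fix f g
    assume f: "(\<forall>i. f i \<in> toric_grading \<Omega> i) \<and> finite {i. f i \<noteq> 0} \<and> r = (\<Sum>i | f i \<noteq> 0. f i)"
      and g: "(\<forall>i. g i \<in> toric_grading \<Omega> i) \<and> finite {i. g i \<noteq> 0} \<and> r = (\<Sum>i | g i \<noteq> 0. g i)"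
    have "f i = g i" for i
      by (rule poly_mapping_eqI) (use component[of f] component[of g] f g in auto)
    then show "f = g" by auto
  qed
  show "poly.subspace (toric_ring \<Omega>)"
    unfolding toric_ring_span by (rule poly.subspace_span)
  show "1 \<in> toric_ring \<Omega>"
    using toric_ring.const[of 1] by simp
qed (auto simp: poly_scale_mult toric_grading_span intro: toric_ring.mult)

section \<open>Straightening as arithmetic of exponent vectors\<close>

text \<open>
  Comparable finite sets are ordered by inclusion as they are by cardinality, so sorting by
  cardinality yields a multichain.
\<close>
lemma ex_multichain_of_pairwise_comparable:
  assumes "set_mset M \<subseteq> H" and comparable: "\<And>\<alpha> \<beta>. \<alpha> \<in># M \<Longrightarrow> \<beta> \<in># M \<Longrightarrow> \<not> incomparable \<alpha> \<beta>"
  shows "\<exists>\<gamma>\<in>multichains H. mset \<gamma> = M"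
proof -
  obtain xs where xs: "mset xs = M" using ex_mset by blast
  define \<gamma> where "\<gamma> = sort_key card xs"
  have mset: "mset \<gamma> = M" by (simp add: \<gamma>_def xs)
  then have set: "set \<gamma> = set_mset M" by auto
  have "sorted_wrt (\<lambda>\<alpha> \<beta>. card \<alpha> \<le> card \<beta>) \<gamma>"
    using sorted_sort_key[of card xs] by (simp add: \<gamma>_def sorted_map)
  then have "sorted_wrt (\<le>) \<gamma>"
  proof (rule sorted_wrt_mono_rel[rotated])
    fix \<alpha> \<beta> assume *: "\<alpha> \<in> set \<gamma>" "\<beta> \<in> set \<gamma>" "card \<alpha> \<le> card \<beta>"
    then have "finite \<alpha>" using assms(1) set finite_P
      by (auto simp: poset_ideals_def intro: finite_subset)
    then show "\<alpha> \<le> \<beta>" using comparable[of \<alpha> \<beta>] * set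
      unfolding incomparable_def by (metis card_seteq order_refl)
  qed
  then show ?thesis using mset set assms(1) by (auto simp: multichains_def)
qed

text \<open>
  Every product of generators is a standard monomial: straighten incomparable factors as long as
  there are any. Cardinalities alone need not grow in total, since \<open>\<beta>\<close> may be much smaller than
  \<open>\<alpha> \<inter> \<alpha>'\<close>. But \<open>\<beta>'\<close> properly contains both \<open>\<alpha>\<close> and \<open>\<alpha>'\<close>, so
  \<open>2 ^ card \<alpha> + 2 ^ card \<alpha>' \<le> 2 ^ card \<beta>'\<close>. The weight \<open>\<Sum>\<alpha>. 2 ^ card \<alpha>\<close> therefore increases, while it
  stays bounded because the number of factors is fixed.
\<close>
lemma ex_multichain_of_straightens:
  assumes straight: "\<And>\<alpha> \<alpha>'. \<alpha> \<in> H \<Longrightarrow> \<alpha>' \<in> H \<Longrightarrow> incomparable \<alpha> \<alpha>' \<Longrightarrow>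
      \<exists>\<beta> \<beta>'. straightens P e \<alpha> \<alpha>' \<beta> \<beta>'"
    and "set_mset M \<subseteq> H"
  shows "\<exists>\<gamma>\<in>multichains H. exponent_sum e \<gamma> = (\<Sum>\<alpha>\<in>#M. e \<alpha>)"
  using assms(2)
proof (induction "size M * 2 ^ card P - (\<Sum>\<alpha>\<in>#M. 2 ^ card \<alpha>)" arbitrary: M rule: less_induct)
  case less
  show ?case
  proof (cases "\<exists>\<alpha> \<alpha>'. \<alpha> \<in># M \<and> \<alpha>' \<in># M \<and> incomparable \<alpha> \<alpha>'")
    case False
    then obtain \<gamma> where "\<gamma> \<in> multichains H" "mset \<gamma> = M"
      using ex_multichain_of_pairwise_comparable[OF less.prems] by blast
    then show ?thesis by (metis mset_map sum_mset_sum_list)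
  next
    case True
    then obtain \<alpha> \<alpha>' where \<alpha>: "\<alpha> \<in># M" "\<alpha>' \<in># M" "incomparable \<alpha> \<alpha>'" by blast
    then have "\<alpha> \<noteq> \<alpha>'" by (auto simp: incomparable_def)
    with \<alpha> obtain N where M: "M = add_mset \<alpha> (add_mset \<alpha>' N)"
      by (metis insert_noteq_member mset_add)
    obtain \<beta> \<beta>' where \<beta>: "straightens P e \<alpha> \<alpha>' \<beta> \<beta>'" using straight \<alpha> less.prems by blast
    define M' where "M' = add_mset \<beta> (add_mset \<beta>' N)"
    have H': "set_mset M' \<subseteq> H" using \<beta> less.prems by (auto simp: M'_def M straightens_def)
    have weight_le: "(\<Sum>\<alpha>\<in>#L. (2::nat) ^ card \<alpha>) \<le> size L * 2 ^ card P" if "set_mset L \<subseteq> H" for L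
      using that
    proof (induction L)
      case (add \<delta> L)
      then have "(2::nat) ^ card \<delta> \<le> 2 ^ card P"
        using finite_P by (intro power_increasing card_mono) (auto simp: poset_ideals_def)
      then show ?case using add by (auto intro!: add_mono)
    qed simp
    have "finite \<beta>'" using \<beta> finite_P finite_subset by (auto simp: straightens_def poset_ideals_def)
    moreover have "\<alpha> \<subset> \<beta>'" "\<alpha>' \<subset> \<beta>'"
      using \<beta> \<alpha>(3) by (auto simp: straightens_def incomparable_def)
    ultimately have "Suc (card \<alpha>) \<le> card \<beta>'" "Suc (card \<alpha>') \<le> card \<beta>'"
      by (simp_all add: Suc_leI psubset_card_mono)
    then have "(2::nat) ^ Suc (card \<alpha>) \<le> 2 ^ card \<beta>'" "(2::nat) ^ Suc (card \<alpha>') \<le> 2 ^ card \<beta>'"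
      by (simp_all only: power_increasing one_le_numeral)
    moreover have "(0::nat) < 2 ^ card \<beta>" by simp
    ultimately have "(2::nat) ^ card \<alpha> + 2 ^ card \<alpha>' < 2 ^ card \<beta> + 2 ^ card \<beta>'"
      unfolding power_Suc by linarith
    then have "(\<Sum>\<alpha>\<in>#M. 2 ^ card \<alpha>) < (\<Sum>\<alpha>\<in>#M'. (2::nat) ^ card \<alpha>)"
      by (simp add: M M'_def)
    moreover have "size M = size M'" by (simp add: M M'_def)
    ultimately have "size M' * 2 ^ card P - (\<Sum>\<alpha>\<in>#M'. 2 ^ card \<alpha>) <
        size M * 2 ^ card P - (\<Sum>\<alpha>\<in>#M. 2 ^ card \<alpha>)"
      using weight_le[OF H'] by simp
    from less.hyps[OF this H'] obtain \<gamma> where "\<gamma> \<in> multichains H"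
      "exponent_sum e \<gamma> = (\<Sum>\<alpha>\<in>#M'. e \<alpha>)" by blast
    moreover have "(\<Sum>\<alpha>\<in>#M'. e \<alpha>) = (\<Sum>\<alpha>\<in>#M. e \<alpha>)"
    proof -
      have "(\<Sum>\<alpha>\<in>#M. e \<alpha>) = (e \<alpha> + e \<alpha>') + (\<Sum>\<alpha>\<in>#N. e \<alpha>)" by (simp add: M add.assoc)
      also have "\<dots> = (e \<beta> + e \<beta>') + (\<Sum>\<alpha>\<in>#N. e \<alpha>)" using \<beta> by (simp add: straightens_def)
      also have "\<dots> = (\<Sum>\<alpha>\<in>#M'. e \<alpha>)" by (simp add: M'_def add.assoc)
      finally show ?thesis by simp
    qed
    ultimately show ?thesis by (intro bexI[of _ \<gamma>]) simp_all
  qed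
qed

lemma pair_multichain: "straightens P e \<alpha> \<alpha>' \<beta> \<beta>' \<Longrightarrow> [\<beta>, \<beta>'] \<in> multichains H"
  by (auto simp: straightens_def multichains_def)

lemma std_monomials_distinct_iff:
  "inj_on (std_monomial (omega w)) (multichains H) \<longleftrightarrow> inj_on (exponent_sum e) (multichains H)"
proof -
  have "inj_on (std_monomial (omega w)) (multichains H) \<longleftrightarrow>
      inj_on (\<lambda>\<gamma>. monomial (exponent_sum e \<gamma>) :: ('a, 'k) polynomial) (multichains H)"
    by (rule inj_on_cong) (auto simp: multichains_def std_monomial_eq)
  also have "\<dots> \<longleftrightarrow> inj_on (exponent_sum e) (multichains H)"
    by (simp add: inj_on_def)
  finally show ?thesis .
qed

text \<open>
  If distinct multichains have distinct exponent sums, a standard monomial has only the trivial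
  standard expression: compare the coefficients of each monomial.
\<close>
lemma standard_expression_monomial:
  assumes inj: "inj_on (exponent_sum e) (multichains H)" and \<delta>: "\<delta> \<in> multichains H"
  shows "standard_expression poly_scale H (omega w) c (monomial (exponent_sum e \<delta>)) \<longleftrightarrow>
    c = (\<lambda>\<gamma>. if \<gamma> = \<delta> then 1 else 0)" (is "?L \<longleftrightarrow> c = ?c")
proof
  assume "c = ?c"
  then have "c \<gamma> \<noteq> 0 \<longleftrightarrow> \<gamma> = \<delta>" "c \<delta> = 1" for \<gamma> by auto
  then show ?L using \<delta> std_monomial_eq[of \<delta>]
    by (simp add: standard_expression_def multichains_def)
next
  assume ?L
  then have fin: "finite {\<gamma>. c \<gamma> \<noteq> 0}" and sub: "{\<gamma>. c \<gamma> \<noteq> 0} \<subseteq> multichains H"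
    and sum: "monomial (exponent_sum e \<delta>) = (\<Sum>\<gamma> | c \<gamma> \<noteq> 0. poly_scale (c \<gamma>) (std_monomial (omega w) \<gamma>))"
    by (auto simp: standard_expression_def)
  have "c \<gamma> = ?c \<gamma>" for \<gamma>
  proof (cases "\<gamma> \<in> multichains H")
    case True
    have "?c \<gamma> = Poly_Mapping.lookup (monomial (exponent_sum e \<delta>)) (exponent_sum e \<gamma>)"
      using inj_on_eq_iff[OF inj True \<delta>] by (auto simp: lookup_single when_def)
    also have "\<dots> = (\<Sum>\<epsilon> | c \<epsilon> \<noteq> 0. if \<epsilon> = \<gamma> then c \<epsilon> else 0)"
      unfolding sum lookup_sum
    proof (rule sum.cong)
      fix \<epsilon> assume "\<epsilon> \<in> {\<epsilon>. c \<epsilon> \<noteq> 0}"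
      then have \<epsilon>: "\<epsilon> \<in> multichains H" using sub by blast
      then have "set \<epsilon> \<subseteq> H" by (simp add: multichains_def)
      then show "Poly_Mapping.lookup (poly_scale (c \<epsilon>) (std_monomial (omega w) \<epsilon>)) (exponent_sum e \<gamma>) =
          (if \<epsilon> = \<gamma> then c \<epsilon> else 0)"
        using inj_on_eq_iff[OF inj \<epsilon> True]
        by (auto simp: lookup_poly_scale std_monomial_eq lookup_single when_def)
    qed simp
    also have "\<dots> = c \<gamma>" using fin by simp
    finally show ?thesis by simp
  qed (use sub \<delta> in auto)
  then show "c = ?c" by auto
qed

text \<open>
  One equation between exponent vectors thus determines the straightening relation of \<open>\<alpha>, \<alpha>'\<close>
  completely, and equivalence of two compatible ASL can be tested on such equations.
\<close>
lemma straightening_relation_iff: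
  assumes "inj_on (exponent_sum e) (multichains H)" and "straightens P e \<alpha> \<alpha>' \<beta> \<beta>'"
    and "\<alpha> \<in> H" "\<alpha>' \<in> H" "incomparable \<alpha> \<alpha>'"
  shows "straightening_relation poly_scale H (omega w) \<alpha> \<alpha>' c \<longleftrightarrow>
    c = (\<lambda>\<gamma>. if \<gamma> = [\<beta>, \<beta>'] then 1 else 0)"
proof -
  have "omega w \<alpha> * omega w \<alpha>' = monomial (exponent_sum e [\<beta>, \<beta>'])"
    using assms by (simp add: omega_eq monomial_mult straightens_def)
  then show ?thesis
    using standard_expression_monomial[OF assms(1) pair_multichain[OF assms(2)]] assms(3-5)
    by (simp add: straightening_relation_def)
qed

lemma span_std_monomials:
  assumes "\<And>\<alpha> \<alpha>'. \<alpha> \<in> H \<Longrightarrow> \<alpha>' \<in> H \<Longrightarrow> incomparable \<alpha> \<alpha>' \<Longrightarrow>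
      \<exists>\<beta> \<beta>'. straightens P e \<alpha> \<alpha>' \<beta> \<beta>'"
  shows "poly.span (monomial ` exponent_sum e ` multichains H) = toric_ring \<Omega>"
proof -
  have "monomial (exponent_sum e \<gamma>) \<in> monomial ` exponent_sum e ` multichains H" if \<gamma>: "set \<gamma> \<subseteq> H" for \<gamma>
  proof -
    obtain \<delta> where "\<delta> \<in> multichains H" "exponent_sum e \<delta> = exponent_sum e \<gamma>"
      using ex_multichain_of_straightens[OF assms, of "mset \<gamma>"] \<gamma>
      by (auto simp: sum_mset_sum_list simp flip: mset_map)
    then show ?thesis by (metis imageI)
  qed
  moreover have "set \<gamma> \<subseteq> H" if "\<gamma> \<in> multichains H" for \<gamma>
    using that by (simp add: multichains_def)
  ultimately have "monomial ` exponent_sum e ` multichains H =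
      {monomial (exponent_sum e \<gamma>) :: ('a, 'k) polynomial | \<gamma>. set \<gamma> \<subseteq> H}" by blast
  then show ?thesis by (simp add: toric_ring_span)
qed

text \<open>
  Distinct exponent sums and straightening equations are necessary. The spanning property provides
  some straightening relation, compatibility gives its form, and the exponents give the equation.
\<close>
lemma
  assumes compatible: "compatible_asl P w"
  shows compatible_asl_inj: "inj_on (exponent_sum e) (multichains H)" (is ?inj)
    and compatible_asl_straightens: "\<alpha> \<in> H \<Longrightarrow> \<alpha>' \<in> H \<Longrightarrow> incomparable \<alpha> \<alpha>' \<Longrightarrow>
      \<exists>\<beta> \<beta>'. straightens P e \<alpha> \<alpha>' \<beta> \<beta>'"
proof -
  interpret asl poly_scale "toric_ring \<Omega>" "toric_grading \<Omega>" H "omega w"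
    using compatible by (simp add: compatible_asl_def toric_asl_def)
  show inj: ?inj using std_monomials_distinct by (simp add: std_monomials_distinct_iff)
  assume \<alpha>: "\<alpha> \<in> H" "\<alpha>' \<in> H" "incomparable \<alpha> \<alpha>'"
  have "omega w \<alpha> * omega w \<alpha>' \<in> poly.span (std_monomial (omega w) ` multichains H)"
    using \<alpha> unfolding std_monomials_span by (intro toric_ring.intros) auto
  then obtain t r where t: "finite t" "t \<subseteq> std_monomial (omega w) ` multichains H"
    "omega w \<alpha> * omega w \<alpha>' = (\<Sum>a\<in>t. poly_scale (r a) a)"
    unfolding poly.span_explicit by blast
  obtain M where M: "M \<subseteq> multichains H" "t = std_monomial (omega w) ` M" "finite M"
    using t(1,2) by (meson finite_subset_image)
  \<comment> \<open>The spanning property gives coefficients indexed by elements of the ring. As distinct multichains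
     have distinct standard monomials, they can be indexed by multichains instead.\<close>
  define c where "c \<gamma> = (if \<gamma> \<in> M then r (std_monomial (omega w) \<gamma>) else 0)" for \<gamma>
  have "omega w \<alpha> * omega w \<alpha>' =
      (\<Sum>\<gamma>\<in>M. poly_scale (r (std_monomial (omega w) \<gamma>)) (std_monomial (omega w) \<gamma>))"
    unfolding t(3) M(2)
    using sum.reindex[OF inj_on_subset[OF std_monomials_distinct M(1)]] by (simp add: o_def)
  also have "\<dots> = (\<Sum>\<gamma> | c \<gamma> \<noteq> 0. poly_scale (c \<gamma>) (std_monomial (omega w) \<gamma>))"
    using M(3) by (intro sum.mono_neutral_cong_right) (auto simp: c_def)
  finally have "standard_expression poly_scale H (omega w) c (omega w \<alpha> * omega w \<alpha>')"
    using M unfolding standard_expression_def by (auto simp: c_def)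
  then have "straightening_relation poly_scale H (omega w) \<alpha> \<alpha>' c"
    using \<alpha> by (simp add: straightening_relation_def)
  moreover from this obtain \<beta> \<beta>' where \<beta>: "\<beta> \<in> H" "\<beta>' \<in> H" "\<beta> \<subseteq> \<alpha> \<inter> \<alpha>'" "\<alpha> \<union> \<alpha>' \<subseteq> \<beta>'"
    "c = (\<lambda>\<gamma>. if \<gamma> = [\<beta>, \<beta>'] then 1 else 0)"
    using compatible unfolding compatible_asl_def by blast
  ultimately have "monomial (e \<alpha> + e \<alpha>') =
      (\<Sum>\<gamma> | c \<gamma> \<noteq> 0. poly_scale (c \<gamma>) (std_monomial (omega w) \<gamma>))"
    using \<alpha> by (simp add: straightening_relation_def standard_expression_def omega_eq monomial_mult)
  also have "\<dots> = monomial (exponent_sum e [\<beta>, \<beta>'])"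
    using \<beta>(1,2) std_monomial_eq[of "[\<beta>, \<beta>']"] by (simp add: \<beta>(5))
  finally show "\<exists>\<beta> \<beta>'. straightens P e \<alpha> \<alpha>' \<beta> \<beta>'"
    using \<beta> by (auto simp: straightens_def)
qed

text \<open>
  The criterion is sufficient: independence of the standard monomials is that of distinct
  monomials, they span because straightening ends, and the uniqueness of standard expressions makes
  every straightening relation the given one, whose first factor lies below \<open>\<alpha>\<close> and \<open>\<alpha>'\<close>.
\<close>
lemma compatible_aslI:
  assumes inj: "inj_on (exponent_sum e) (multichains H)"
    and straight: "\<And>\<alpha> \<alpha>'. \<alpha> \<in> H \<Longrightarrow> \<alpha>' \<in> H \<Longrightarrow> incomparable \<alpha> \<alpha>' \<Longrightarrow>
      \<exists>\<beta> \<beta>'. straightens P e \<alpha> \<alpha>' \<beta> \<beta>'"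
  shows "compatible_asl P w"
proof -
  have relation: "\<exists>\<beta> \<beta>'. straightens P e \<alpha> \<alpha>' \<beta> \<beta>' \<and> c = (\<lambda>\<gamma>. if \<gamma> = [\<beta>, \<beta>'] then 1 else 0)"
    if "straightening_relation poly_scale H (omega w) \<alpha> \<alpha>' c" for \<alpha> \<alpha>' c
  proof -
    have \<alpha>: "\<alpha> \<in> H" "\<alpha>' \<in> H" "incomparable \<alpha> \<alpha>'"
      using that by (simp_all add: straightening_relation_def)
    then obtain \<beta> \<beta>' where \<beta>: "straightens P e \<alpha> \<alpha>' \<beta> \<beta>'" using straight by blast
    show ?thesis using straightening_relation_iff[OF inj \<beta> \<alpha>, of c] \<beta> that by blast
  qed
  have std_image: "std_monomial (omega w) ` multichains H = monomial ` exponent_sum e ` multichains H"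
    unfolding image_image by (intro image_cong) (auto simp: multichains_def std_monomial_eq)
  have "asl poly_scale (toric_ring \<Omega>) (toric_grading \<Omega>) H (omega w)"
  proof (intro asl.intro graded_algebra_toric asl_axioms.intro)
    show "finite H" using finite_P by (rule finite_poset_ideals)
    show "inj_on (omega w) H"
    proof (rule inj_onI)
      fix \<alpha> \<beta> assume "\<alpha> \<in> H" "\<beta> \<in> H" "omega w \<alpha> = omega w \<beta>"
      then show "\<alpha> = \<beta>" using inj_onD[OF inj, of "[\<alpha>]" "[\<beta>]"]
        by (simp add: omega_eq multichains_def)
    qed
    show "\<exists>d\<ge>1. omega w \<alpha> \<in> toric_grading \<Omega> d" if "\<alpha> \<in> H" for \<alpha>
      using that unfolding toric_grading_span
      by (intro exI[of _ 1] conjI poly.span_base) (auto simp: omega_eq intro!: exI[of _ "[\<alpha>]"])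
    show "inj_on (std_monomial (omega w)) (multichains H)"
      using inj by (simp add: std_monomials_distinct_iff)
    show "poly.independent (std_monomial (omega w) ` multichains H)"
      unfolding std_image by (rule independent_monomials)
    show "poly.span (std_monomial (omega w) ` multichains H) = toric_ring \<Omega>"
      unfolding std_image by (rule span_std_monomials[OF straight])
    show "\<gamma> \<noteq> [] \<and> hd \<gamma> \<le> \<alpha> \<and> hd \<gamma> \<le> \<beta>"
      if "straightening_relation poly_scale H (omega w) \<alpha> \<beta> c" "c \<gamma> \<noteq> 0" for \<alpha> \<beta> c \<gamma>
      using relation[OF that(1)] that(2) by (auto simp: straightens_def split: if_splits)
  qed
  moreover have "\<exists>\<beta>\<in>H. \<exists>\<beta>'\<in>H. \<beta> \<subseteq> \<alpha> \<inter> \<alpha>' \<and> \<alpha> \<union> \<alpha>' \<subseteq> \<beta>' \<and>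
      c = (\<lambda>\<gamma>. if \<gamma> = [\<beta>, \<beta>'] then 1 else 0)"
    if "straightening_relation poly_scale H (omega w) \<alpha> \<alpha>' c" for \<alpha> \<alpha>' c
    using relation[OF that] unfolding straightens_def by blast
  ultimately show "compatible_asl P w"
    unfolding compatible_asl_def toric_asl_def by (simp add: w_monomial)
qed

lemma multichain_length_eq:
  assumes "\<gamma> \<in> multichains H" "\<delta> \<in> multichains H" "exponent_sum e \<gamma> = exponent_sum e \<delta>"
  shows "length \<gamma> = length \<delta>"
  using assms lookup_exponent_sum_T[of \<gamma>] lookup_exponent_sum_T[of \<delta>] by (simp add: multichains_def)

text \<open>
  To recover a multichain from its exponent sum it suffices to recover one end of it, cancel the
  corresponding generator and repeat.
\<close>
lemma inj_on_exponent_sum_of_last: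
  assumes last: "\<And>\<gamma> \<delta>. \<gamma> \<in> multichains H \<Longrightarrow> \<delta> \<in> multichains H \<Longrightarrow> \<gamma> \<noteq> [] \<Longrightarrow> \<delta> \<noteq> [] \<Longrightarrow>
    exponent_sum e \<gamma> = exponent_sum e \<delta> \<Longrightarrow> last \<gamma> = last \<delta>"
  shows "inj_on (exponent_sum e) (multichains H)"
proof (rule inj_onI)
  fix \<gamma> \<delta> assume *: "\<gamma> \<in> multichains H" "\<delta> \<in> multichains H" "exponent_sum e \<gamma> = exponent_sum e \<delta>"
  from multichain_length_eq[OF this] this show "\<gamma> = \<delta>"
  proof (induction \<gamma> arbitrary: \<delta> rule: rev_induct)
    case (snoc \<alpha> \<gamma>)
    then obtain \<beta> \<delta>' where \<delta>: "\<delta> = \<delta>' @ [\<beta>]" by (cases \<delta> rule: rev_cases) auto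
    have "\<alpha> = \<beta>" using last[OF snoc.prems(2,3)] snoc.prems(4) \<delta> by simp
    then show ?case using snoc \<delta> by (auto simp: multichains_def sorted_wrt_append)
  qed simp
qed

lemma inj_on_exponent_sum_of_hd:
  assumes hd: "\<And>\<gamma> \<delta>. \<gamma> \<in> multichains H \<Longrightarrow> \<delta> \<in> multichains H \<Longrightarrow> \<gamma> \<noteq> [] \<Longrightarrow> \<delta> \<noteq> [] \<Longrightarrow>
    exponent_sum e \<gamma> = exponent_sum e \<delta> \<Longrightarrow> hd \<gamma> = hd \<delta>"
  shows "inj_on (exponent_sum e) (multichains H)"
proof (rule inj_onI)
  fix \<gamma> \<delta> assume *: "\<gamma> \<in> multichains H" "\<delta> \<in> multichains H" "exponent_sum e \<gamma> = exponent_sum e \<delta>"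
  from multichain_length_eq[OF this] this show "\<gamma> = \<delta>"
  proof (induction \<gamma> arbitrary: \<delta>)
    case (Cons \<alpha> \<gamma>)
    then obtain \<beta> \<delta>' where \<delta>: "\<delta> = \<beta> # \<delta>'" by (cases \<delta>) auto
    have "\<alpha> = \<beta>" using hd[OF Cons.prems(2,3)] Cons.prems(4) \<delta> by simp
    then show ?case using Cons \<delta> by (auto simp: multichains_def)
  qed simp
qed

end

lemma ex_toric_family:
  assumes "finite P" and w: "\<And>\<alpha>. \<alpha> \<in> poset_ideals P \<Longrightarrow> w \<alpha> \<in> x_monomials P"
  shows "\<exists>e. toric_family P w e"
proof -
  have "\<forall>\<alpha>\<in>poset_ideals P. \<exists>m. omega w \<alpha> = monomial m"
  proof
    fix \<alpha> assume "\<alpha> \<in> poset_ideals P"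
    then obtain k where "w \<alpha> = monomial (x_vector P k)" using w x_monomials_eq by blast
    then have "omega w \<alpha> = monomial (x_vector P k + Poly_Mapping.single T 1)"
      by (simp add: omega_def variable_def monomial_mult)
    then show "\<exists>m. omega w \<alpha> = monomial m" by blast
  qed
  then obtain e where "\<forall>\<alpha>\<in>poset_ideals P. omega w \<alpha> = monomial (e \<alpha>)" by metis
  then show ?thesis using assms by (auto simp: toric_family_def)
qed

lemma asl_equivI:
  assumes "toric_family P w e" "toric_family P w' e'" "compatible_asl P w" "compatible_asl P w'"
    and straight: "\<And>\<alpha> \<alpha>'. \<alpha> \<in> poset_ideals P \<Longrightarrow> \<alpha>' \<in> poset_ideals P \<Longrightarrow> incomparable \<alpha> \<alpha>' \<Longrightarrow>
      \<exists>\<beta> \<beta>'. straightens P e \<alpha> \<alpha>' \<beta> \<beta>' \<and> straightens P e' \<alpha> \<alpha>' \<beta> \<beta>'"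
  shows "asl_equiv P w w'"
proof -
  interpret w: toric_family P w e by fact
  interpret w': toric_family P w' e' by fact
  have "straightening_relation poly_scale (poset_ideals P) (omega w) \<alpha> \<alpha>' c \<longleftrightarrow>
      straightening_relation poly_scale (poset_ideals P) (omega w') \<alpha> \<alpha>' c" for \<alpha> \<alpha>' c
  proof (cases "\<alpha> \<in> poset_ideals P \<and> \<alpha>' \<in> poset_ideals P \<and> incomparable \<alpha> \<alpha>'")
    case True
    then have \<alpha>: "\<alpha> \<in> poset_ideals P" "\<alpha>' \<in> poset_ideals P" "incomparable \<alpha> \<alpha>'" by auto
    obtain \<beta> \<beta>' where "straightens P e \<alpha> \<alpha>' \<beta> \<beta>'" "straightens P e' \<alpha> \<alpha>' \<beta> \<beta>'"
      using straight[OF \<alpha>] by blast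
    then show ?thesis
      using w.straightening_relation_iff[OF w.compatible_asl_inj _ \<alpha>]
        w'.straightening_relation_iff[OF w'.compatible_asl_inj _ \<alpha>] assms(3,4) by simp
  qed (auto simp: straightening_relation_def)
  then show ?thesis using assms(3,4) by (simp add: asl_equiv_def)
qed

text \<open>
  Equations can be transferred between equivalent ASL. This is how a known relation of one ring
  yields an equation in another ring without computing the straightening there.
\<close>
lemma asl_equiv_straightens:
  assumes "toric_family P w e" "toric_family P w' e'" "asl_equiv P w w'"
    and \<alpha>: "\<alpha> \<in> poset_ideals P" "\<alpha>' \<in> poset_ideals P" "incomparable \<alpha> \<alpha>'"
    and straight: "straightens P e \<alpha> \<alpha>' \<beta> \<beta>'"
  shows "straightens P e' \<alpha> \<alpha>' \<beta> \<beta>'"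
proof -
  interpret w: toric_family P w e by fact
  interpret w': toric_family P w' e' by fact
  have compatible: "compatible_asl P w" "compatible_asl P w'"
    using assms(3) by (auto simp: asl_equiv_def)
  let ?c = "\<lambda>\<beta> \<beta>' \<gamma>. if \<gamma> = [\<beta>, \<beta>'] then 1 else 0 :: 'b"
  obtain \<delta> \<delta>' where \<delta>: "straightens P e' \<alpha> \<alpha>' \<delta> \<delta>'"
    using w'.compatible_asl_straightens[OF compatible(2) \<alpha>] by blast
  have "straightening_relation poly_scale (poset_ideals P) (omega w) \<alpha> \<alpha>' (?c \<beta> \<beta>')"
    using w.straightening_relation_iff[OF w.compatible_asl_inj straight \<alpha>] compatible by simp
  then have "straightening_relation poly_scale (poset_ideals P) (omega w') \<alpha> \<alpha>' (?c \<beta> \<beta>')"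
    using assms(3) unfolding asl_equiv_def by blast
  then have "?c \<beta> \<beta>' = ?c \<delta> \<delta>'"
    using w'.straightening_relation_iff[OF w'.compatible_asl_inj \<delta> \<alpha>] compatible by simp
  from fun_cong[OF this, of "[\<delta>, \<delta>']"] have "\<beta> = \<delta>" "\<beta>' = \<delta>'" by (auto split: if_splits)
  with \<delta> show ?thesis by simp
qed

lemma asl_equiv_trans: "asl_equiv P w w' \<Longrightarrow> asl_equiv P w' w'' \<Longrightarrow> asl_equiv P w w''"
  by (simp add: asl_equiv_def)

lemma asl_equiv_sym: "asl_equiv P w w' \<Longrightarrow> asl_equiv P w' w"
  by (simp add: asl_equiv_def)

section \<open>The three families of squarefree monomials\<close>

text \<open>
  The exponent vectors of the generators \<open>u (S \<alpha>) * variable T\<close>. All three rings of the theorem have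
  generators of this form.
\<close>
definition subset_exponent :: "'a set \<Rightarrow> ('a set \<Rightarrow> 'a set) \<Rightarrow> 'a set \<Rightarrow> ('a var \<Rightarrow>\<^sub>0 nat)" where
  "subset_exponent P S \<alpha> = x_vector P (\<lambda>p. of_bool (p \<in> S \<alpha>)) + Poly_Mapping.single T 1"

lemma toric_family_subset:
  assumes "finite P" "\<And>\<alpha>. \<alpha> \<in> poset_ideals P \<Longrightarrow> S \<alpha> \<subseteq> P"
  shows "toric_family P (\<lambda>\<alpha>. u (S \<alpha>)) (subset_exponent P S)"
  using assms
  by unfold_locales
    (auto simp: u_eq x_monomials_eq subset_exponent_def omega_def variable_def monomial_mult
      simp del: One_nat_def)

lemma lookup_subset_exponent:
  "finite P \<Longrightarrow> p \<in> P \<Longrightarrow> Poly_Mapping.lookup (subset_exponent P S \<alpha>) (X p) = of_bool (p \<in> S \<alpha>)"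
  by (simp add: subset_exponent_def lookup_add lookup_x_vector_X lookup_single)

lemma lookup_exponent_sum_subset_exponent:
  assumes "finite P" "p \<in> P"
  shows "0 < Poly_Mapping.lookup (exponent_sum (subset_exponent P S) \<gamma>) (X p) \<longleftrightarrow> (\<exists>\<alpha>\<in>set \<gamma>. p \<in> S \<alpha>)"
  using assms by (induction \<gamma>) (auto simp: lookup_add lookup_subset_exponent)

lemma subset_exponent_add_eq_iff:
  assumes "finite P"
  shows "subset_exponent P S \<alpha> + subset_exponent P S \<alpha>' = subset_exponent P S \<beta> + subset_exponent P S \<beta>' \<longleftrightarrow>
    (\<forall>p\<in>P. of_bool (p \<in> S \<alpha>) + of_bool (p \<in> S \<alpha>') = (of_bool (p \<in> S \<beta>) + of_bool (p \<in> S \<beta>') :: nat))"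
    (is "?l = ?r \<longleftrightarrow> ?counts")
proof
  assume "?l = ?r"
  then have "Poly_Mapping.lookup ?l (X p) = Poly_Mapping.lookup ?r (X p)" for p by simp
  then show ?counts
    unfolding lookup_add using lookup_subset_exponent[OF assms] by (metis (no_types, lifting))
next
  assume counts: ?counts
  show "?l = ?r"
  proof (rule poly_mapping_eqI)
    fix v
    show "Poly_Mapping.lookup ?l v = Poly_Mapping.lookup ?r v"
      using assms counts
      by (cases v) (auto simp: subset_exponent_def lookup_add lookup_x_vector_X lookup_x_vector_T
          lookup_single)
  qed
qed

lemma poset_ideals_Int: "\<alpha> \<in> poset_ideals P \<Longrightarrow> \<beta> \<in> poset_ideals P \<Longrightarrow> \<alpha> \<inter> \<beta> \<in> poset_ideals P"
  and poset_ideals_Un: "\<alpha> \<in> poset_ideals P \<Longrightarrow> \<beta> \<in> poset_ideals P \<Longrightarrow> \<alpha> \<union> \<beta> \<in> poset_ideals P"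
  by (auto simp: poset_ideals_def)

lemma ex_maximal_above:
  assumes "finite A" "p \<in> A"
  obtains q where "q \<in> maximal_elements A" "p \<le> q"
  using finite_has_maximal2[OF assms] by (auto simp: maximal_elements_def)

lemma ex_minimal_below:
  assumes "finite A" "p \<in> A"
  obtains q where "q \<in> minimal_elements A" "q \<le> p"
  using finite_has_minimal2[OF assms] by (auto simp: minimal_elements_def)

text \<open>
  If each \<open>S \<alpha>\<close> generates the ideal \<open>\<alpha>\<close>, the largest member of a multichain is the ideal generated
  by all variables that occur in the product. This covers \<open>S \<alpha> = \<alpha>\<close> as well as
  \<open>S \<alpha> = maximal_elements \<alpha>\<close>.
\<close>
lemma inj_on_exponent_sum_of_generators:
  assumes "finite P" and S: "\<And>\<alpha>. \<alpha> \<in> poset_ideals P \<Longrightarrow> S \<alpha> \<subseteq> \<alpha>"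
    and generate: "\<And>\<alpha> p. \<alpha> \<in> poset_ideals P \<Longrightarrow> p \<in> \<alpha> \<Longrightarrow> \<exists>q\<in>S \<alpha>. p \<le> q"
  shows "inj_on (exponent_sum (subset_exponent P S)) (multichains (poset_ideals P))"
proof -
  have SP: "S \<alpha> \<subseteq> P" if "\<alpha> \<in> poset_ideals P" for \<alpha>
    using S[OF that] that by (auto simp: poset_ideals_def)
  interpret toric_family P "\<lambda>\<alpha>. u (S \<alpha>)" "subset_exponent P S"
    using assms(1) SP by (rule toric_family_subset)
  have last: "last \<gamma> = {p \<in> P. \<exists>q\<in>P. p \<le> q \<and> 0 < Poly_Mapping.lookup (exponent_sum (subset_exponent P S) \<gamma>) (X q)}"
    (is "_ = ?R") if \<gamma>: "\<gamma> \<in> multichains H" "\<gamma> \<noteq> []" for \<gamma>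
  proof (intro equalityI subsetI)
    have ideal: "last \<gamma> \<in> H" using \<gamma> by (auto simp: multichains_def)
    fix p
    {
      assume p: "p \<in> last \<gamma>"
      then obtain q where "q \<in> S (last \<gamma>)" "p \<le> q" using generate ideal by blast
      then show "p \<in> ?R" using p ideal SP[OF ideal] \<gamma> assms(1)
        by (auto simp: lookup_exponent_sum_subset_exponent poset_ideals_def intro!: bexI[of _ q] bexI[of _ "last \<gamma>"])
    }
    assume "p \<in> ?R"
    then obtain q \<alpha> where q: "p \<in> P" "p \<le> q" "\<alpha> \<in> set \<gamma>" "q \<in> S \<alpha>"
      using assms(1) by (auto simp: lookup_exponent_sum_subset_exponent)
    have "\<alpha> \<subseteq> last \<gamma>"
      using q(3) \<gamma> by (cases \<gamma> rule: rev_cases) (auto simp: multichains_def sorted_wrt_append)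
    moreover have "q \<in> \<alpha>" using q(3,4) S \<gamma> by (auto simp: multichains_def)
    ultimately show "p \<in> last \<gamma>" using ideal q by (auto simp: poset_ideals_def)
  qed
  show ?thesis by (rule inj_on_exponent_sum_of_last) (simp add: last)
qed

text \<open>
  Dually, the smallest member of a multichain is the complement of the filter generated by all
  variables that occur in the product.
\<close>
lemma inj_on_exponent_sum_of_cogenerators:
  assumes "finite P" and S: "\<And>\<alpha>. \<alpha> \<in> poset_ideals P \<Longrightarrow> S \<alpha> \<subseteq> P - \<alpha>"
    and generate: "\<And>\<alpha> p. \<alpha> \<in> poset_ideals P \<Longrightarrow> p \<in> P - \<alpha> \<Longrightarrow> \<exists>q\<in>S \<alpha>. q \<le> p"
  shows "inj_on (exponent_sum (subset_exponent P S)) (multichains (poset_ideals P))"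
proof -
  have SP: "S \<alpha> \<subseteq> P" if "\<alpha> \<in> poset_ideals P" for \<alpha>
    using S[OF that] by auto
  interpret toric_family P "\<lambda>\<alpha>. u (S \<alpha>)" "subset_exponent P S"
    using assms(1) SP by (rule toric_family_subset)
  have hd: "P - hd \<gamma> = {p \<in> P. \<exists>q\<in>P. q \<le> p \<and> 0 < Poly_Mapping.lookup (exponent_sum (subset_exponent P S) \<gamma>) (X q)}"
    (is "_ = ?R") if \<gamma>: "\<gamma> \<in> multichains H" "\<gamma> \<noteq> []" for \<gamma>
  proof (intro equalityI subsetI)
    have ideal: "hd \<gamma> \<in> H" using \<gamma> by (auto simp: multichains_def)
    fix p
    {
      assume p: "p \<in> P - hd \<gamma>"
      then obtain q where "q \<in> S (hd \<gamma>)" "q \<le> p" using generate ideal by blast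
      then show "p \<in> ?R" using p SP[OF ideal] \<gamma> assms(1)
        by (auto simp: lookup_exponent_sum_subset_exponent intro!: bexI[of _ q] bexI[of _ "hd \<gamma>"])
    }
    assume "p \<in> ?R"
    then obtain q \<alpha> where q: "p \<in> P" "q \<in> P" "q \<le> p" "\<alpha> \<in> set \<gamma>" "q \<in> S \<alpha>"
      using assms(1) by (auto simp: lookup_exponent_sum_subset_exponent)
    have "hd \<gamma> \<subseteq> \<alpha>" using q(4) \<gamma> by (cases \<gamma>) (auto simp: multichains_def)
    moreover have "q \<notin> \<alpha>" using q(4,5) S \<gamma> by (auto simp: multichains_def)
    ultimately show "p \<in> P - hd \<gamma>" using ideal q by (auto simp: poset_ideals_def)
  qed
  show ?thesis
  proof (rule inj_on_exponent_sum_of_hd)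
    fix \<gamma> \<delta> assume *: "\<gamma> \<in> multichains H" "\<delta> \<in> multichains H" "\<gamma> \<noteq> []" "\<delta> \<noteq> []"
      "exponent_sum (subset_exponent P S) \<gamma> = exponent_sum (subset_exponent P S) \<delta>"
    then have "P - hd \<gamma> = P - hd \<delta>" by (simp add: hd)
    moreover have "hd \<gamma> \<subseteq> P" "hd \<delta> \<subseteq> P"
      using * by (auto simp: multichains_def poset_ideals_def dest!: hd_in_set)
    ultimately show "hd \<gamma> = hd \<delta>" by blast
  qed
qed

lemma maximal_elements_generated:
  "A \<in> antichains P \<Longrightarrow> maximal_elements {q \<in> P. \<exists>p\<in>A. q \<le> p} = A"
  unfolding maximal_elements_def antichains_def incomparable_def
  by (auto intro: order_trans antisym) (metis antisym order_trans subsetD)+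

lemma minimal_elements_generated:
  "A \<in> antichains P \<Longrightarrow> minimal_elements {q \<in> P. \<exists>p\<in>A. p \<le> q} = A"
  unfolding minimal_elements_def antichains_def incomparable_def
  by (auto intro: order_trans antisym) (metis antisym order_trans subsetD)+

lemma toric_family_order:
  "finite P \<Longrightarrow> toric_family P (order_family P) (subset_exponent P (\<lambda>\<alpha>. \<alpha>))"
  unfolding order_family_def[abs_def]
  by (rule toric_family_subset) (auto simp: poset_ideals_def)

lemma toric_family_chain:
  "finite P \<Longrightarrow> toric_family P (chain_family P) (subset_exponent P maximal_elements)"
  unfolding chain_family_def[abs_def]
  by (rule toric_family_subset) (auto simp: poset_ideals_def maximal_elements_def)

lemma toric_family_dual_chain:
  "finite P \<Longrightarrow>
    toric_family P (dual_chain_family P) (subset_exponent P (\<lambda>\<alpha>. minimal_elements (P - \<alpha>)))"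
  unfolding dual_chain_family_def[abs_def]
  by (rule toric_family_subset) (auto simp: minimal_elements_def)

lemma straightens_order:
  assumes "finite P" "\<alpha> \<in> poset_ideals P" "\<alpha>' \<in> poset_ideals P"
  shows "straightens P (subset_exponent P (\<lambda>\<alpha>. \<alpha>)) \<alpha> \<alpha>' (\<alpha> \<inter> \<alpha>') (\<alpha> \<union> \<alpha>')"
  using assms
  by (auto simp: straightens_def subset_exponent_add_eq_iff poset_ideals_Int poset_ideals_Un)

text \<open>
  The straightening relation \<open>\<psi>(\<alpha>) \<psi>(\<alpha>') = \<psi>(\<alpha> \<ast> \<alpha>') \<psi>(\<alpha> \<union> \<alpha>')\<close>. A maximal element of \<open>\<alpha>\<close> or
  \<open>\<alpha>'\<close> remains maximal in \<open>\<alpha> \<union> \<alpha>'\<close> unless it is a non-maximal element of the other ideal. The set \<open>A\<close>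
  collects those that get lost, and those that are maximal in both ideals and have to be
  counted twice.
\<close>
lemma straightens_chain:
  assumes "finite P" and \<alpha>: "\<alpha> \<in> poset_ideals P" "\<alpha>' \<in> poset_ideals P"
  defines "A \<equiv> maximal_elements (\<alpha> \<inter> \<alpha>') \<inter> (maximal_elements \<alpha> \<union> maximal_elements \<alpha>')"
  shows "straightens P (subset_exponent P maximal_elements) \<alpha> \<alpha>'
    {q \<in> P. \<exists>p\<in>A. q \<le> p} (\<alpha> \<union> \<alpha>')" (is "straightens _ _ _ _ ?\<beta> _")
proof -
  have A: "A \<in> antichains P"
    using \<alpha> by (auto simp: A_def antichains_def maximal_elements_def incomparable_def poset_ideals_def)
  have "?\<beta> \<in> poset_ideals P"
    by (auto simp: poset_ideals_def intro: order_trans)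
  moreover have "?\<beta> \<subseteq> \<alpha> \<inter> \<alpha>'"
    using \<alpha> by (auto simp: A_def maximal_elements_def poset_ideals_def)
  moreover have "of_bool (p \<in> maximal_elements \<alpha>) + of_bool (p \<in> maximal_elements \<alpha>') =
      (of_bool (p \<in> A) + of_bool (p \<in> maximal_elements (\<alpha> \<union> \<alpha>')) :: nat)" if "p \<in> P" for p
  proof -
    have "p \<in> maximal_elements (\<alpha> \<union> \<alpha>') \<longleftrightarrow>
        (p \<in> maximal_elements \<alpha> \<or> p \<in> maximal_elements \<alpha>') \<and>
        (p \<in> \<alpha> \<longrightarrow> p \<in> maximal_elements \<alpha>) \<and> (p \<in> \<alpha>' \<longrightarrow> p \<in> maximal_elements \<alpha>')"
      using \<alpha> that by (auto simp: maximal_elements_def poset_ideals_def)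
    moreover have "p \<in> A \<longleftrightarrow> p \<in> \<alpha> \<inter> \<alpha>' \<and> (p \<in> maximal_elements \<alpha> \<or> p \<in> maximal_elements \<alpha>')"
      by (auto simp: A_def maximal_elements_def)
    moreover have "maximal_elements \<alpha> \<subseteq> \<alpha>" "maximal_elements \<alpha>' \<subseteq> \<alpha>'"
      by (auto simp: maximal_elements_def)
    ultimately show ?thesis by auto
  qed
  ultimately show ?thesis
    using assms(1) \<alpha> maximal_elements_generated[OF A]
    by (simp add: straightens_def subset_exponent_add_eq_iff poset_ideals_Un)
qed

text \<open>
  The relation \<open>\<delta>(\<alpha>) \<delta>(\<alpha>') = \<delta>(\<alpha> \<inter> \<alpha>') \<delta>(\<alpha> \<circ> \<alpha>')\<close>, by the same count for the minimal elements of the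
  complementary filters.
\<close>
lemma straightens_dual_chain:
  assumes "finite P" and \<alpha>: "\<alpha> \<in> poset_ideals P" "\<alpha>' \<in> poset_ideals P"
  defines "A \<equiv> minimal_elements ((P - \<alpha>) \<inter> (P - \<alpha>')) \<inter>
    (minimal_elements (P - \<alpha>) \<union> minimal_elements (P - \<alpha>'))"
  shows "straightens P (subset_exponent P (\<lambda>\<alpha>. minimal_elements (P - \<alpha>))) \<alpha> \<alpha>'
    (\<alpha> \<inter> \<alpha>') (P - {q \<in> P. \<exists>p\<in>A. p \<le> q})" (is "straightens _ _ _ _ _ (P - ?F)")
proof -
  have A: "A \<in> antichains P"
    using \<alpha> by (auto simp: A_def antichains_def minimal_elements_def incomparable_def)
  have "P - ?F \<in> poset_ideals P"
    by (auto simp: poset_ideals_def intro: order_trans)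
  moreover have "\<alpha> \<union> \<alpha>' \<subseteq> P - ?F"
    using \<alpha> by (auto simp: A_def minimal_elements_def poset_ideals_def)
  moreover have "of_bool (p \<in> minimal_elements (P - \<alpha>)) + of_bool (p \<in> minimal_elements (P - \<alpha>')) =
      (of_bool (p \<in> minimal_elements (P - \<alpha> \<inter> \<alpha>')) + of_bool (p \<in> A) :: nat)" if "p \<in> P" for p
  proof -
    have "p \<in> minimal_elements (P - \<alpha> \<inter> \<alpha>') \<longleftrightarrow>
        (p \<in> minimal_elements (P - \<alpha>) \<or> p \<in> minimal_elements (P - \<alpha>')) \<and>
        (p \<notin> \<alpha> \<longrightarrow> p \<in> minimal_elements (P - \<alpha>)) \<and> (p \<notin> \<alpha>' \<longrightarrow> p \<in> minimal_elements (P - \<alpha>'))"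
      using \<alpha> that by (auto simp: minimal_elements_def poset_ideals_def)
    moreover have "p \<in> A \<longleftrightarrow> p \<notin> \<alpha> \<and> p \<notin> \<alpha>' \<and>
        (p \<in> minimal_elements (P - \<alpha>) \<or> p \<in> minimal_elements (P - \<alpha>'))"
      using that by (auto simp: A_def minimal_elements_def)
    moreover have "minimal_elements (P - \<alpha>) \<subseteq> P - \<alpha>" "minimal_elements (P - \<alpha>') \<subseteq> P - \<alpha>'"
      by (auto simp: minimal_elements_def)
    ultimately show ?thesis by auto
  qed
  moreover have "P - (P - ?F) = ?F" by auto
  ultimately show ?thesis
    using assms(1) \<alpha> minimal_elements_generated[OF A]
    by (simp add: straightens_def subset_exponent_add_eq_iff poset_ideals_Int)
qed

lemma compatible_order:
  assumes "finite P"
  shows "compatible_asl P (order_family P)"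
proof (rule toric_family.compatible_aslI[OF toric_family_order[OF assms]])
  show "inj_on (exponent_sum (subset_exponent P (\<lambda>\<alpha>. \<alpha>))) (multichains (poset_ideals P))"
    using assms by (rule inj_on_exponent_sum_of_generators) auto
qed (use straightens_order[OF assms] in blast)

lemma compatible_chain:
  assumes "finite P"
  shows "compatible_asl P (chain_family P)"
proof (rule toric_family.compatible_aslI[OF toric_family_chain[OF assms]])
  show "inj_on (exponent_sum (subset_exponent P maximal_elements)) (multichains (poset_ideals P))"
  proof (rule inj_on_exponent_sum_of_generators[OF assms])
    fix \<alpha> p assume "\<alpha> \<in> poset_ideals P" "p \<in> \<alpha>"
    moreover from this(1) have "finite \<alpha>"
      using assms by (auto simp: poset_ideals_def intro: finite_subset)
    ultimately show "\<exists>q\<in>maximal_elements \<alpha>. p \<le> q" by (metis ex_maximal_above)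
  qed (auto simp: maximal_elements_def)
qed (use straightens_chain[OF assms] in blast)

lemma compatible_dual_chain:
  assumes "finite P"
  shows "compatible_asl P (dual_chain_family P)"
proof (rule toric_family.compatible_aslI[OF toric_family_dual_chain[OF assms]])
  show "inj_on (exponent_sum (subset_exponent P (\<lambda>\<alpha>. minimal_elements (P - \<alpha>)))) (multichains (poset_ideals P))"
  proof (rule inj_on_exponent_sum_of_cogenerators[OF assms])
    fix \<alpha> p assume "p \<in> P - \<alpha>"
    moreover have "finite (P - \<alpha>)" using assms by simp
    ultimately show "\<exists>q\<in>minimal_elements (P - \<alpha>). q \<le> p" by (metis ex_minimal_below)
  qed (auto simp: minimal_elements_def)
qed (use straightens_dual_chain[OF assms] in blast)

section \<open>Disjoint unions of chains\<close>

text \<open>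
  These sets are the unions of connected components. In this form no paths in the comparability
  graph are needed, and such unions can be treated by induction on their size.
\<close>
definition comparability_closed :: "'a::order set \<Rightarrow> 'a set \<Rightarrow> bool" where
  "comparability_closed P C \<longleftrightarrow> C \<subseteq> P \<and> (\<forall>p\<in>C. \<forall>q\<in>P. p \<le> q \<or> q \<le> p \<longrightarrow> q \<in> C)"

lemma comparability_closed_subset: "comparability_closed P C \<Longrightarrow> C \<subseteq> P"
  and comparability_closedD:
    "comparability_closed P C \<Longrightarrow> p \<in> C \<Longrightarrow> q \<in> P \<Longrightarrow> p \<le> q \<or> q \<le> p \<Longrightarrow> q \<in> C"
  unfolding comparability_closed_def by blast+

lemma poset_ideals_subset: "\<alpha> \<in> poset_ideals P \<Longrightarrow> \<alpha> \<subseteq> P"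
  by (simp add: poset_ideals_def)

lemma comparability_closed_self: "comparability_closed P P"
  by (simp add: comparability_closed_def)

lemma poset_ideals_Int_closed:
  assumes "\<eta> \<in> poset_ideals P" and C: "comparability_closed P C"
  shows "\<eta> \<inter> C \<in> poset_ideals P"
  unfolding poset_ideals_def
proof (intro CollectI conjI ballI impI)
  fix p q assume *: "p \<in> \<eta> \<inter> C" "q \<in> P" "q \<le> p"
  then have "q \<in> \<eta>" using assms(1) unfolding poset_ideals_def by blast
  then show "q \<in> \<eta> \<inter> C" using comparability_closedD[OF C, of p q] * by simp
qed (use assms(1) in \<open>auto simp: poset_ideals_def\<close>)

lemma comparability_closed_Diff:
  assumes C: "comparability_closed P C" and B: "comparability_closed P B"
  shows "comparability_closed P (C - B)"
  unfolding comparability_closed_def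
proof (intro conjI ballI impI)
  show "C - B \<subseteq> P" using comparability_closed_subset[OF C] by blast
  fix p q assume *: "p \<in> C - B" "q \<in> P" "p \<le> q \<or> q \<le> p"
  then have "p \<in> P" using \<open>C - B \<subseteq> P\<close> by blast
  with * show "q \<in> C - B"
    using comparability_closedD[OF C, of p q] comparability_closedD[OF B, of q p] by blast
qed

definition comparability_transitive :: "'a::order set \<Rightarrow> bool" where
  "comparability_transitive P \<longleftrightarrow> (\<forall>p\<in>P. \<forall>q\<in>P. \<forall>r\<in>P.
     (p \<le> q \<or> q \<le> p) \<and> (q \<le> r \<or> r \<le> q) \<longrightarrow> p \<le> r \<or> r \<le> p)"

text \<open>
  Comparability is reflexive and symmetric. If it is transitive, paths do not lead to new elements,
  and a component consists of elements comparable to one another.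
\<close>
lemma comparability_transitive_iff_components:
  "comparability_transitive P \<longleftrightarrow>
    (\<forall>C\<in>connected_components P. Complete_Partial_Order.chain (\<le>) C)"
proof
  assume trans: "comparability_transitive P"
  show "\<forall>C\<in>connected_components P. Complete_Partial_Order.chain (\<le>) C"
  proof
    fix C assume "C \<in> connected_components P"
    then obtain x where x: "x \<in> P" "C = (comparability_graph P)\<^sup>* `` {x}"
      by (auto simp: connected_components_def elim: quotientE)
    have comparable: "y \<in> P \<and> (x \<le> y \<or> y \<le> x)" if "(x, y) \<in> (comparability_graph P)\<^sup>*" for y
      using that
    proof induction
      case (step y z)
      then have "z \<in> P" "y \<le> z \<or> z \<le> y" by (auto simp: comparability_graph_def)
      then show ?case using step trans x(1) unfolding comparability_transitive_def by blast
    qed (use x in simp)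
    show "Complete_Partial_Order.chain (\<le>) C"
    proof (rule chainI)
      fix y z assume "y \<in> C" "z \<in> C"
      then show "y \<le> z \<or> z \<le> y"
        using comparable[of y] comparable[of z] trans x
        unfolding comparability_transitive_def by blast
    qed
  qed
next
  assume chains: "\<forall>C\<in>connected_components P. Complete_Partial_Order.chain (\<le>) C"
  show "comparability_transitive P"
    unfolding comparability_transitive_def
  proof (intro ballI impI)
    fix p q r assume *: "p \<in> P" "q \<in> P" "r \<in> P" "(p \<le> q \<or> q \<le> p) \<and> (q \<le> r \<or> r \<le> q)"
    let ?C = "(comparability_graph P)\<^sup>* `` {q}"
    have "?C \<in> connected_components P"
      unfolding connected_components_def using *(2) by (rule quotientI)
    then have chain: "Complete_Partial_Order.chain (\<le>) ?C" using chains by blast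
    have member: "s \<in> ?C" if "s \<in> P" "s \<le> q \<or> q \<le> s" for s
      using that *(2) by (cases "s = q") (auto simp: comparability_graph_def)
    have "p \<in> ?C" "r \<in> ?C" using member[of p] member[of r] * by auto
    then show "p \<le> r \<or> r \<le> p" by (rule chainD[OF chain])
  qed
qed

text \<open>
  Failure of transitivity at \<open>p, q, r\<close> means that \<open>q\<close> is a common lower or a common upper bound of
  incomparable \<open>p\<close> and \<open>r\<close>. The chain polytope excludes the former and the dual chain polytope the
  latter: in the transferred order relation for the principal ideals (or the complements of the
  principal filters) of \<open>p\<close> and \<open>r\<close>, a variable \<open>z\<close> other than \<open>p\<close> and \<open>r\<close> occurs on one side only.
\<close>
lemma comparability_transitive_of_equiv:
  assumes P: "finite P"
    and chain: "asl_equiv P (order_family P :: 'a::order set \<Rightarrow> ('a, 'k::field) polynomial) (chain_family P)"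
    and dual: "asl_equiv P (order_family P :: 'a set \<Rightarrow> ('a, 'k) polynomial) (dual_chain_family P)"
  shows "comparability_transitive P"
proof -
  have no_common_lower: False
    if *: "p \<in> P" "q \<in> P" "r \<in> P" "q \<le> p" "q \<le> r" "\<not> p \<le> r" "\<not> r \<le> p" for p q r
  proof -
    define \<alpha> where "\<alpha> = {x \<in> P. x \<le> p}"
    define \<beta> where "\<beta> = {x \<in> P. x \<le> r}"
    have ideals: "\<alpha> \<in> poset_ideals P" "\<beta> \<in> poset_ideals P"
      by (auto simp: \<alpha>_def \<beta>_def poset_ideals_def intro: order_trans)
    have incomparable: "incomparable \<alpha> \<beta>" using * by (auto simp: incomparable_def \<alpha>_def \<beta>_def)
    have "straightens P (subset_exponent P maximal_elements) \<alpha> \<beta> (\<alpha> \<inter> \<beta>) (\<alpha> \<union> \<beta>)"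
      by (rule asl_equiv_straightens[OF toric_family_order[OF P] toric_family_chain[OF P] chain ideals
            incomparable straightens_order[OF P ideals]])
    then have counts: "of_bool (x \<in> maximal_elements \<alpha>) + of_bool (x \<in> maximal_elements \<beta>) =
        (of_bool (x \<in> maximal_elements (\<alpha> \<inter> \<beta>)) + of_bool (x \<in> maximal_elements (\<alpha> \<union> \<beta>)) :: nat)"
      if "x \<in> P" for x
      using P that unfolding straightens_def by (simp only: subset_exponent_add_eq_iff)
    have "finite (\<alpha> \<inter> \<beta>)" "q \<in> \<alpha> \<inter> \<beta>" using P * by (auto simp: \<alpha>_def \<beta>_def)
    then obtain z where z: "z \<in> maximal_elements (\<alpha> \<inter> \<beta>)" by (rule ex_maximal_above)
    then have "z \<in> \<alpha>" "z \<in> \<beta>" by (auto simp: maximal_elements_def)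
    then have "z \<notin> maximal_elements \<alpha>" "z \<notin> maximal_elements \<beta>"
      using * by (auto simp: maximal_elements_def \<alpha>_def \<beta>_def)
    then show False using counts[of z] z \<open>z \<in> \<alpha>\<close> by (simp add: \<alpha>_def)
  qed
  have no_common_upper: False
    if *: "p \<in> P" "q \<in> P" "r \<in> P" "p \<le> q" "r \<le> q" "\<not> p \<le> r" "\<not> r \<le> p" for p q r
  proof -
    define \<alpha> where "\<alpha> = {x \<in> P. \<not> p \<le> x}"
    define \<beta> where "\<beta> = {x \<in> P. \<not> r \<le> x}"
    let ?S = "\<lambda>\<alpha>. minimal_elements (P - \<alpha>)"
    have ideals: "\<alpha> \<in> poset_ideals P" "\<beta> \<in> poset_ideals P"
      by (auto simp: \<alpha>_def \<beta>_def poset_ideals_def intro: order_trans)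
    have incomparable: "incomparable \<alpha> \<beta>" using * by (auto simp: incomparable_def \<alpha>_def \<beta>_def)
    have "straightens P (subset_exponent P ?S) \<alpha> \<beta> (\<alpha> \<inter> \<beta>) (\<alpha> \<union> \<beta>)"
      by (rule asl_equiv_straightens[OF toric_family_order[OF P] toric_family_dual_chain[OF P] dual ideals
            incomparable straightens_order[OF P ideals]])
    then have counts: "of_bool (x \<in> ?S \<alpha>) + of_bool (x \<in> ?S \<beta>) =
        (of_bool (x \<in> ?S (\<alpha> \<inter> \<beta>)) + of_bool (x \<in> ?S (\<alpha> \<union> \<beta>)) :: nat)"
      if "x \<in> P" for x
      using P that unfolding straightens_def by (simp only: subset_exponent_add_eq_iff)
    have "finite (P - (\<alpha> \<union> \<beta>))" "q \<in> P - (\<alpha> \<union> \<beta>)" using P * by (auto simp: \<alpha>_def \<beta>_def)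
    then obtain z where z: "z \<in> ?S (\<alpha> \<union> \<beta>)" by (rule ex_minimal_below)
    then have zP: "z \<in> P" "p \<le> z" "r \<le> z" by (auto simp: minimal_elements_def \<alpha>_def \<beta>_def)
    then have "z \<notin> ?S \<alpha>" "z \<notin> ?S \<beta>"
      using * by (auto simp: minimal_elements_def \<alpha>_def \<beta>_def)
    then show False using counts[of z] z zP by simp
  qed
  show ?thesis
    unfolding comparability_transitive_def
    using no_common_lower no_common_upper by (blast intro: order_trans)
qed

section \<open>Uniqueness over disjoint unions of chains\<close>

context toric_family
begin

text \<open>
  The product of \<open>x\<close> and \<open>y\<close> straightens to \<open>{}\<close> and some \<open>z \<supseteq> x \<union> y\<close>, and the claim is that \<open>z\<close> is
  not larger than \<open>x \<union> y\<close>. Otherwise split \<open>z = x' \<union> y'\<close> along \<open>C\<close>. By downward induction on the size of \<open>x \<union> y\<close>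
  the claim holds for all pairs with a larger union, in particular for \<open>x', y'\<close>, whence
  \<open>e x + e y = e x' + e y'\<close>. As \<open>e\<close> is injective, \<open>x\<close> and \<open>y\<close> must both be proper subsets of \<open>x'\<close> and
  \<open>y'\<close>. The claim also holds for the mixed pairs \<open>x, y'\<close> and \<open>x', y\<close>, and adding up gives
  \<open>e (x \<union> y') + e (x' \<union> y) = e z + e z\<close>. So the incomparable ideals \<open>x \<union> y'\<close> and \<open>x' \<union> y\<close> straighten to
  \<open>z, z\<close>, but the smaller member of a straightened pair is contained in their intersection \<open>x \<union> y\<close>.
\<close>
lemma compatible_disjoint_additive:
  assumes compatible: "compatible_asl P w" and C: "comparability_closed P C"
    and "x \<in> H" "y \<in> H" "x \<subseteq> C" "y \<inter> C = {}"
  shows "e x + e y = e (x \<union> y) + e {}"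
  using assms(3-)
proof (induction "card P - card (x \<union> y)" arbitrary: x y rule: less_induct)
  case less
  note inj = compatible_asl_inj[OF compatible]
  have inj1: "\<alpha> = \<beta>" if "\<alpha> \<in> H" "\<beta> \<in> H" "e \<alpha> = e \<beta>" for \<alpha> \<beta>
    using inj_onD[OF inj, of "[\<alpha>]" "[\<beta>]"] that by (simp add: multichains_def)
  show ?case
  proof (cases "x = {} \<or> y = {}")
    case False
    then have "incomparable x y" using less.prems by (auto simp: incomparable_def)
    then obtain \<beta> z where "straightens P e x y \<beta> z"
      using compatible_asl_straightens[OF compatible] less.prems by blast
    moreover have "x \<inter> y = {}" using less.prems by auto
    ultimately have z: "z \<in> H" "x \<union> y \<subseteq> z" "e x + e y = e {} + e z"
      by (auto simp: straightens_def)
    show ?thesis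
    proof (rule ccontr)
      assume contra: "e x + e y \<noteq> e (x \<union> y) + e {}"
      define x' where "x' = z \<inter> C"
      define y' where "y' = z - C"
      have zP: "z \<subseteq> P" using z(1) by (rule poset_ideals_subset)
      have xy': "x' \<in> H" "y' \<in> H" "x' \<subseteq> C" "y' \<inter> C = {}" "x' \<union> y' = z"
      proof -
        have "comparability_closed P (P - C)"
          using comparability_closed_self C by (rule comparability_closed_Diff)
        moreover have "y' = z \<inter> (P - C)" using zP by (auto simp: y'_def)
        ultimately show "x' \<in> H" "y' \<in> H"
          using poset_ideals_Int_closed[OF z(1)] C by (simp_all add: x'_def)
      qed (auto simp: x'_def y'_def)
      have sub: "x \<subseteq> x'" "y \<subseteq> y'" using z less.prems by (auto simp: x'_def y'_def)
      have IH: "e a + e b = e (a \<union> b) + e {}"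
        if "a \<in> H" "b \<in> H" "a \<subseteq> C" "b \<inter> C = {}" "x \<union> y \<subset> a \<union> b" for a b
      proof (rule less.hyps[OF _ that(1-4)])
        have ab: "a \<union> b \<subseteq> P" using that(1,2)[THEN poset_ideals_subset] by blast
        have "card (x \<union> y) < card (a \<union> b)"
          using finite_subset[OF ab finite_P] that(5) by (rule psubset_card_mono)
        moreover have "card (a \<union> b) \<le> card P"
          using finite_P ab by (rule card_mono)
        ultimately show "card P - card (a \<union> b) < card P - card (x \<union> y)" by simp
      qed
      have "x \<union> y \<noteq> z" using z(3) contra by (auto simp: add.commute)
      then have xyz: "e x' + e y' = e z + e {}" using IH[of x' y'] xy' z(2) by auto
      then have sum: "e x + e y = e x' + e y'" using z(3) by (simp add: add.commute)
      have "x \<noteq> x'" using inj1[OF less.prems(2) xy'(2)] sum \<open>x \<union> y \<noteq> z\<close> xy'(5) by auto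
      moreover have "y \<noteq> y'" using inj1[OF less.prems(1) xy'(1)] sum \<open>x \<union> y \<noteq> z\<close> xy'(5) by auto
      ultimately have strict: "x \<subset> x'" "y \<subset> y'" using sub by auto
      have disjoint: "x' \<inter> y' = {}" using xy'(3,4) by blast
      have bigger: "x \<union> y \<subset> x \<union> y'" "x \<union> y \<subset> x' \<union> y"
        using strict disjoint by blast+
      have mixed: "e x + e y' = e (x \<union> y') + e {}" "e x' + e y = e (x' \<union> y) + e {}"
        using IH[OF less.prems(1) xy'(2) less.prems(3) xy'(4) bigger(1)]
          IH[OF xy'(1) less.prems(2) xy'(3) less.prems(4) bigger(2)] .
      \<comment> \<open>An equation between exponent vectors follows from equations in each coordinate, where linear
         arithmetic over the natural numbers does the cancellation.\<close>
      have double: "e (x \<union> y') + e (x' \<union> y) = e z + e z"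
      proof (rule poly_mapping_eqI)
        fix v
        show "Poly_Mapping.lookup (e (x \<union> y') + e (x' \<union> y)) v = Poly_Mapping.lookup (e z + e z) v"
          using mixed[THEN arg_cong, of "\<lambda>f. Poly_Mapping.lookup f v"]
            arg_cong[OF sum, of "\<lambda>f. Poly_Mapping.lookup f v"]
            arg_cong[OF xyz, of "\<lambda>f. Poly_Mapping.lookup f v"]
          unfolding lookup_add by linarith
      qed
      have H': "x \<union> y' \<in> H" "x' \<union> y \<in> H" using less.prems(1,2) xy'(1,2) by (simp_all add: poset_ideals_Un)
      have "incomparable (x \<union> y') (x' \<union> y)"
        using strict disjoint unfolding incomparable_def by blast
      then obtain \<delta> \<delta>' where \<delta>: "straightens P e (x \<union> y') (x' \<union> y) \<delta> \<delta>'"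
        using compatible_asl_straightens[OF compatible H'] by blast
      then have "exponent_sum e [\<delta>, \<delta>'] = exponent_sum e [z, z]"
        using double by (simp add: straightens_def)
      moreover have "[z, z] \<in> multichains H" using z by (simp add: multichains_def)
      ultimately have "[\<delta>, \<delta>'] = [z, z]" by (rule inj_onD[OF inj _ pair_multichain[OF \<delta>]])
      then have "\<delta> = z" by simp
      then have "z \<subseteq> (x \<union> y') \<inter> (x' \<union> y)" using \<delta> by (simp add: straightens_def)
      then show False using strict disjoint xy'(5) by blast
    qed
  qed (auto simp: add.commute)
qed

text \<open>
  Split off the chain \<open>B\<close> of all elements comparable to one \<open>p \<in> C\<close>. On \<open>B\<close> the ideals \<open>\<alpha>\<close> and \<open>\<alpha>'\<close>
  are comparable, on \<open>C - B\<close> the induction hypothesis applies, and additivity combines the two parts.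
  The terms \<open>e {}\<close> cancel since both sides acquire the same number of them.
\<close>
lemma compatible_modular_on_closed:
  assumes compatible: "compatible_asl P w" and trans: "comparability_transitive P"
    and \<alpha>: "\<alpha> \<in> H" "\<alpha>' \<in> H" and "comparability_closed P C"
  shows "e (\<alpha> \<inter> C) + e (\<alpha>' \<inter> C) = e (\<alpha> \<inter> \<alpha>' \<inter> C) + e ((\<alpha> \<union> \<alpha>') \<inter> C)"
  using assms(5)
proof (induction "card C" arbitrary: C rule: less_induct)
  case less
  note C = less.prems
  then have "finite C" using finite_P comparability_closed_subset finite_subset by metis
  show ?case
  proof (cases "C = {}")
    case False
    then obtain p where p: "p \<in> C" by blast
    then have pP: "p \<in> P" using comparability_closed_subset[OF C] by blast
    define B where "B = {q \<in> P. p \<le> q \<or> q \<le> p}"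
    have transD: "q \<le> s \<or> s \<le> q" if "q \<in> P" "r \<in> P" "s \<in> P" "q \<le> r \<or> r \<le> q" "r \<le> s \<or> s \<le> r" for q r s
      using trans that unfolding comparability_transitive_def by metis
    have comparable: "q \<le> r \<or> r \<le> q" if "q \<in> B" "r \<in> B" for q r
      using transD[of q p r] pP that by (auto simp: B_def)
    have B: "comparability_closed P B"
      unfolding comparability_closed_def
    proof (intro conjI ballI impI)
      fix q r assume "q \<in> B" "r \<in> P" "q \<le> r \<or> r \<le> q"
      then show "r \<in> B" using transD[OF pP, of q r] by (simp add: B_def)
    qed (auto simp: B_def)
    have BC: "B \<subseteq> C" using comparability_closedD[OF C p] by (auto simp: B_def)
    have D: "comparability_closed P (C - B)"
      using C B by (rule comparability_closed_Diff)
    have "card (C - B) < card C"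
      using p pP \<open>finite C\<close> by (intro psubset_card_mono) (auto simp: B_def)
    note IH = less.hyps[OF this D]
    have split: "e (\<eta> \<inter> B) + e (\<eta> \<inter> (C - B)) = e (\<eta> \<inter> C) + e {}" if \<eta>: "\<eta> \<in> H" for \<eta>
    proof -
      have "\<eta> \<inter> B \<union> \<eta> \<inter> (C - B) = \<eta> \<inter> C" using BC by auto
      then show ?thesis
        using compatible_disjoint_additive[OF compatible B, of "\<eta> \<inter> B" "\<eta> \<inter> (C - B)"]
          poset_ideals_Int_closed[OF \<eta> B] poset_ideals_Int_closed[OF \<eta> D] by auto
    qed
    have "\<alpha> \<inter> B \<subseteq> \<alpha>' \<inter> B \<or> \<alpha>' \<inter> B \<subseteq> \<alpha> \<inter> B"
    proof (rule ccontr)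
      assume "\<not> ?thesis"
      then obtain q r where "q \<in> B" "q \<in> \<alpha>" "q \<notin> \<alpha>'" "r \<in> B" "r \<in> \<alpha>'" "r \<notin> \<alpha>" by auto
      with comparable[of q r] show False using \<alpha> by (auto simp: B_def poset_ideals_def)
    qed
    then have "\<alpha> \<inter> \<alpha>' \<inter> B = \<alpha> \<inter> B \<and> (\<alpha> \<union> \<alpha>') \<inter> B = \<alpha>' \<inter> B \<or>
        \<alpha> \<inter> \<alpha>' \<inter> B = \<alpha>' \<inter> B \<and> (\<alpha> \<union> \<alpha>') \<inter> B = \<alpha> \<inter> B" by auto
    then have on_B: "e (\<alpha> \<inter> B) + e (\<alpha>' \<inter> B) = e (\<alpha> \<inter> \<alpha>' \<inter> B) + e ((\<alpha> \<union> \<alpha>') \<inter> B)"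
      by (auto simp: add.commute)
    show ?thesis
    proof (rule poly_mapping_eqI)
      fix v
      let ?v = "\<lambda>f :: 'a var \<Rightarrow>\<^sub>0 nat. Poly_Mapping.lookup f v"
      show "?v (e (\<alpha> \<inter> C) + e (\<alpha>' \<inter> C)) = ?v (e (\<alpha> \<inter> \<alpha>' \<inter> C) + e ((\<alpha> \<union> \<alpha>') \<inter> C))"
        using arg_cong[OF on_B, of ?v] arg_cong[OF IH, of ?v]
          arg_cong[OF split[OF \<alpha>(1)], of ?v] arg_cong[OF split[OF \<alpha>(2)], of ?v]
          arg_cong[OF split[OF poset_ideals_Int[OF \<alpha>]], of ?v]
          arg_cong[OF split[OF poset_ideals_Un[OF \<alpha>]], of ?v]
        unfolding lookup_add by linarith
    qed
  qed simp
qed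

lemma compatible_straightens_modular:
  assumes "compatible_asl P w" "comparability_transitive P" and \<alpha>: "\<alpha> \<in> H" "\<alpha>' \<in> H"
  shows "straightens P e \<alpha> \<alpha>' (\<alpha> \<inter> \<alpha>') (\<alpha> \<union> \<alpha>')"
proof -
  have "\<alpha> \<inter> P = \<alpha>" "\<alpha>' \<inter> P = \<alpha>'" "\<alpha> \<inter> \<alpha>' \<inter> P = \<alpha> \<inter> \<alpha>'" "(\<alpha> \<union> \<alpha>') \<inter> P = \<alpha> \<union> \<alpha>'"
    using \<alpha>[THEN poset_ideals_subset] by blast+
  then show ?thesis
    using compatible_modular_on_closed[OF assms comparability_closed_self] \<alpha>
    by (simp add: straightens_def poset_ideals_Int poset_ideals_Un)
qed

end

text \<open>
  The order polytope ring is compatible and has the modular relations, so it is the unique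
  compatible ASL in this case.
\<close>
lemma compatible_equiv_order:
  assumes P: "finite P" and trans: "comparability_transitive P" and w: "compatible_asl P w"
  shows "asl_equiv P (order_family P) w"
proof -
  have "\<And>\<alpha>. \<alpha> \<in> poset_ideals P \<Longrightarrow> w \<alpha> \<in> x_monomials P"
    using w by (simp add: compatible_asl_def toric_asl_def)
  then obtain e where e: "toric_family P w e" using ex_toric_family[OF P] by blast
  show ?thesis
    using toric_family_order[OF P] e compatible_order[OF P] w
  proof (rule asl_equivI)
    fix \<alpha> \<alpha>' assume "\<alpha> \<in> poset_ideals P" "\<alpha>' \<in> poset_ideals P"
    then show "\<exists>\<beta> \<beta>'. straightens P (subset_exponent P (\<lambda>\<alpha>. \<alpha>)) \<alpha> \<alpha>' \<beta> \<beta>' \<and> straightens P e \<alpha> \<alpha>' \<beta> \<beta>'"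
      using straightens_order[OF P] toric_family.compatible_straightens_modular[OF e w trans] by blast
  qed
qed

theorem theorem1:
  fixes P :: "'a::order set"
  assumes "finite P"
  shows
    "((\<exists>w :: 'a set \<Rightarrow> ('a, 'k::field) polynomial. compatible_asl P w \<and>
         (\<forall>w'. compatible_asl P w' \<longrightarrow> asl_equiv P w w'))
      \<longleftrightarrow>
      (asl_equiv P (order_family P :: 'a set \<Rightarrow> ('a, 'k) polynomial) (chain_family P) \<and>
       asl_equiv P (chain_family P :: 'a set \<Rightarrow> ('a, 'k) polynomial) (dual_chain_family P)))
     \<and>
     ((asl_equiv P (order_family P :: 'a set \<Rightarrow> ('a, 'k) polynomial) (chain_family P) \<and>
       asl_equiv P (chain_family P :: 'a set \<Rightarrow> ('a, 'k) polynomial) (dual_chain_family P))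
      \<longleftrightarrow>
      (\<forall>C\<in>connected_components P. Complete_Partial_Order.chain (\<le>) C))"
    (is "(?i \<longleftrightarrow> ?ii) \<and> (?ii \<longleftrightarrow> ?iii)")
proof -
  note compatible = compatible_order[OF assms] compatible_chain[OF assms] compatible_dual_chain[OF assms]
  have "?ii" if ?i
    using that compatible by (blast intro: asl_equiv_sym asl_equiv_trans)
  moreover have "?iii" if ?ii
    unfolding comparability_transitive_iff_components[symmetric]
    using that by (blast intro: comparability_transitive_of_equiv[OF assms] asl_equiv_trans)
  moreover have "?i" if ?iii
    using that compatible_equiv_order[OF assms] compatible(1)
    unfolding comparability_transitive_iff_components[symmetric] by blast
  ultimately show ?thesis by blast
qed

end
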